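(* Assume $q=g$ and $\alpha_R<1$ (so that $0<\alpha_B<\alpha_R<1$). Then, as $n\to\infty$, $$\frac{A_R^*}{q}\to z_R+\alpha_R\qquad\text{and}\qquad \frac{A_B^*}{q}\to z_B+\alpha_B,\qquad\text{almost surely},$$ where, for $S\in\{R,B\}$, $z_S$ is the smallest (strictly positive) zero of the function $\beta_S(x)=r^{-1}(1-r^{-1})^{r-1}(x+\alpha_S)^r-x$, $x\ge 0$.
   Context: All limits are as $n\to\infty$; $a_n\ll b_n$ means $a_n=o(b_n)$. Fix a constant integer $r\ge 2$. For each $n$ let $p=p_n\in(0,1)$ with $\frac1n\ll p\ll \frac{1}{n^{1/r}\log n}$, and set $$g=g_n:=\Big(1-\frac1r\Big)\Big(\frac{(r-1)!}{n p^r}\Big)^{\frac1{r-1}}.$$ Let $q=q_n$ be a sequence (here $q=g$), and let $a_R=a_R^{(n)},a_B=a_B^{(n)}$ be integers with $a_R/q\to\alpha_R$, $a_B/q\to\alpha_B$, where $\alpha_R>\alpha_B>0$ are constants. Model (competing bootstrap percolation). On the Erdős–Rényi graph $G(n,p)$ with node set $\{1,\dots,n\}$, each node is red ($R$), black ($B$) or white ($W$). At time $0$, $a_R$ uniformly random nodes are set to $R$, then $a_B$ uniformly random nodes among the remaining ones are set to $B$ (the seeds); all other nodes are $W$. Each white node carries an independent unit-rate Poisson clock, independent of the graph and seeds. When the clock of a white node rings, the node takes color $S\in\{R,B\}$ if the number of its neighbors of color $S$ exceeds the number of its neighbors of the opposite color by at least $r$; otherwise it stays white. Colored nodes keep their color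 forever. The process stops when no white node satisfies this threshold condition for either color. $A_S^*$ denotes the final number of nodes of color $S$ (seeds included). The graphs and processes for different $n$ are independent and all defined on one probability space. *)

theory Defs
  imports "HOL-Probability.Probability" "HOL-Library.Landau_Symbols"
begin

datatype colour = Red | Black | White

fun opposite :: "colour \<Rightarrow> colour" where
  "opposite Red = Black"
| "opposite Black = Red"
| "opposite White = White"

text \<open>The randomness of the \<open>n\<close>-th system: the edge set of the graph, the pair of the sets of
  red and black seeds, and the waiting times of the clocks: the \<open>k\<close>-th ring of the clock of node
  \<open>v\<close> comes \<open>\<xi> v k\<close> time units after the previous one (after time 0 if \<open>k = 0\<close>).\<close>

type_synonym sample = "nat set set \<times> (nat set \<times> nat set) \<times> (nat \<Rightarrow> nat \<Rightarrow> real)"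

definition erdos_renyi :: "nat \<Rightarrow> real \<Rightarrow> nat set set pmf" where
  "erdos_renyi n p =
     map_pmf (\<lambda>f. {e. f e})
       (Pi_pmf {e. e \<subseteq> {1..n} \<and> card e = 2} False (\<lambda>_. bernoulli_pmf p))"

definition seeds_pmf :: "nat \<Rightarrow> nat \<Rightarrow> nat \<Rightarrow> (nat set \<times> nat set) pmf" where
  "seeds_pmf n a_R a_B =
     bind_pmf (pmf_of_set {A. A \<subseteq> {1..n} \<and> card A = a_R}) (\<lambda>A.
     map_pmf (Pair A) (pmf_of_set {B. B \<subseteq> {1..n} - A \<and> card B = a_B}))"

text \<open>A unit-rate Poisson clock has independent waiting times with the exponential distribution of
  rate 1. Seeds get a clock too; its rings have no effect.\<close>

definition clocks_measure :: "nat \<Rightarrow> (nat \<Rightarrow> nat \<Rightarrow> real) measure" where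
  "clocks_measure n =
     (\<Pi>\<^sub>M v\<in>{1..n}. \<Pi>\<^sub>M k\<in>UNIV. density lborel (\<lambda>x. ennreal (exponential_density 1 x)))"

definition sample_law :: "nat \<Rightarrow> real \<Rightarrow> nat \<Rightarrow> nat \<Rightarrow> sample measure" where
  "sample_law n p a_R a_B =
     measure_pmf (erdos_renyi n p) \<Otimes>\<^sub>M (measure_pmf (seeds_pmf n a_R a_B) \<Otimes>\<^sub>M clocks_measure n)"

lemma prob_space_sample_law: "prob_space (sample_law n p a_R a_B)"
proof -
  have "prob_space (density lborel (\<lambda>x. ennreal (exponential_density 1 x)))"
    by (rule prob_space_exponential_density) simp
  then have "prob_space (clocks_measure n)"
    unfolding clocks_measure_def by (intro prob_space_PiM)
  then show ?thesis
    unfolding sample_law_def by (intro prob_space_pair measure_pmf.prob_space_axioms)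
qed

definition ring_time :: "(nat \<Rightarrow> nat \<Rightarrow> real) \<Rightarrow> nat \<Rightarrow> nat \<Rightarrow> real" where
  "ring_time \<xi> v k = (\<Sum>j\<le>k. \<xi> v j)"

definition coloured_neighbours ::
    "nat \<Rightarrow> nat set set \<Rightarrow> (nat \<Rightarrow> colour) \<Rightarrow> colour \<Rightarrow> nat \<Rightarrow> nat" where
  "coloured_neighbours n G c S v = card {u \<in> {1..n}. {u, v} \<in> G \<and> c u = S}"

definition threshold ::
    "nat \<Rightarrow> nat \<Rightarrow> nat set set \<Rightarrow> (nat \<Rightarrow> colour) \<Rightarrow> colour \<Rightarrow> nat \<Rightarrow> bool" where
  "threshold n r G c S v \<longleftrightarrow>
     coloured_neighbours n G c S v \<ge> coloured_neighbours n G c (opposite S) v + r"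

definition initial_colouring :: "nat set \<times> nat set \<Rightarrow> nat \<Rightarrow> colour" where
  "initial_colouring seeds v =
     (if v \<in> fst seeds then Red else if v \<in> snd seeds then Black else White)"

text \<open>The update at time \<open>s\<close>, computed from the colouring \<open>c\<close> just before \<open>s\<close>. Almost surely no two
  clocks ring simultaneously, so that at most one node changes.\<close>

definition ring_step ::
    "nat \<Rightarrow> nat \<Rightarrow> nat set set \<Rightarrow> (nat \<Rightarrow> nat \<Rightarrow> real) \<Rightarrow> real
      \<Rightarrow> (nat \<Rightarrow> colour) \<Rightarrow> nat \<Rightarrow> colour" where
  "ring_step n r G \<xi> s c v =
     (if v \<in> {1..n} \<and> c v = White \<and> (\<exists>k. ring_time \<xi> v k = s) then
        if threshold n r G c Red v then Red
        else if threshold n r G c Black v then Black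
        else White
      else c v)"

text \<open>The colouring at time \<open>t\<close> results from processing all rings up to time \<open>t\<close> in chronological
  order. Almost surely these are finitely many for every \<open>t\<close>; otherwise \<open>sorted_list_of_set\<close>
  returns the empty list.\<close>

fun colouring_at :: "nat \<Rightarrow> nat \<Rightarrow> sample \<Rightarrow> real \<Rightarrow> nat \<Rightarrow> colour" where
  "colouring_at n r (G, seeds, \<xi>) t =
     fold (ring_step n r G \<xi>)
       (sorted_list_of_set {s. s \<le> t \<and> (\<exists>v\<in>{1..n}. \<exists>k. ring_time \<xi> v k = s)})
       (initial_colouring seeds)"

definition terminal :: "nat \<Rightarrow> nat \<Rightarrow> nat set set \<Rightarrow> (nat \<Rightarrow> colour) \<Rightarrow> bool" where
  "terminal n r G c \<longleftrightarrow>
     \<not> (\<exists>v\<in>{1..n}. c v = White \<and> (threshold n r G c Red v \<or> threshold n r G c Black v))"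

text \<open>The colouring is piecewise constant and right-continuous in \<open>t\<close>, so the infimum below is
  attained whenever the process stops, which happens almost surely.\<close>

definition stop_time :: "nat \<Rightarrow> nat \<Rightarrow> sample \<Rightarrow> real" where
  "stop_time n r \<omega> = Inf {t. 0 \<le> t \<and> terminal n r (fst \<omega>) (colouring_at n r \<omega> t)}"

definition A_star :: "nat \<Rightarrow> nat \<Rightarrow> sample \<Rightarrow> colour \<Rightarrow> nat" where
  "A_star n r \<omega> S = card {v \<in> {1..n}. colouring_at n r \<omega> (stop_time n r \<omega>) v = S}"

definition crit_size :: "nat \<Rightarrow> (nat \<Rightarrow> real) \<Rightarrow> nat \<Rightarrow> real" where
  "crit_size r p n = (1 - 1 / real r) * (fact (r - 1) / (real n * p n ^ r)) powr (1 / (real r - 1))"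

definition beta_fun :: "nat \<Rightarrow> real \<Rightarrow> real \<Rightarrow> real" where
  "beta_fun r \<alpha> x = 1 / real r * (1 - 1 / real r) ^ (r - 1) * (x + \<alpha>) ^ r - x"

definition least_zero :: "nat \<Rightarrow> real \<Rightarrow> real" where
  "least_zero r \<alpha> = (LEAST x. 0 < x \<and> beta_fun r \<alpha> x = 0)"

end

theory Submission
  imports Defs "HOL-Real_Asymp.Real_Asymp"
begin

text \<open>A node turns red only if it has at least \<open>r\<close> red neighbours, so the final red set lies in the
  closure \<open>K\<^sub>R\<close> of the red seeds under ordinary bootstrap percolation on the nodes that are not black
  seeds, and likewise for black. Conversely, a node without neighbours in \<open>K\<^sub>B\<close> never sees a black
  neighbour; hence, once the process has stopped, the red set contains the closure of the red seeds
  inside the set of nodes not adjacent to \<open>K\<^sub>B\<close>. Both bounds depend only on the graph and the seeds,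
  not on the clocks.

  The sizes of the two closures are estimated by revealing the edges node by node. Allowing a
  different threshold at each node makes the closure satisfy a recursion: remove an active node and
  lower the thresholds of its neighbours by one. Induction along this recursion bounds the
  probability that the closure has a given size by a product of exponential moments of independent
  indicators, i.e. by a Chernoff bound for a binomial variable. Revealing first \<open>K\<^sub>B\<close> and then the red
  closure in the rest costs only a factor \<open>(1 - p)\<close> to the power \<open>|K\<^sub>B|\<close>, which tends to one because
  \<open>p q\<close> tends to zero. The resulting error probabilities are exponentially small in \<open>q\<close>, which grows
  faster than any multiple of \<open>log n\<close>, so Borel--Cantelli applies.\<close>

section \<open>Bootstrap closure with node-dependent thresholds\<close>

text \<open>The constants come from a balance. With \<open>x\<close> active nodes, about
  \<open>n (x p)^r / r!\<close> nodes have \<open>r\<close> active neighbours, and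
  \<open>crit_size\<close> is scaled so that for \<open>x = y q\<close> this is \<open>q\<close>
  times \<open>growth_const r * y ^ r\<close>. Started from \<open>\<alpha> q\<close> seeds, the
  exploration gets past \<open>y q\<close> active nodes only if this exceeds
  \<open>(y - \<alpha>) q\<close>, that is, if \<open>beta_fun\<close> is positive at
  \<open>y - \<alpha>\<close>. It should therefore stall near \<open>y = z + \<alpha>\<close>, with
  \<open>z\<close> the first zero. The obstacle is that the explored nodes are chosen adaptively.
  Instead of a filtration or a coupling, the bounds are stated for all thresholds and all
  sufficiently large edge sets, so the induction hypothesis applies to whatever the revealed edges
  leave behind. The two sides are not symmetric. A closure that is too large is one event, bounded
  with a base \<open>l > 1\<close>. For one that is too small, a base \<open>l < 1\<close> controls
  only exact sizes; these are summed, which requires \<open>beta_fun\<close> to be bounded away from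
  0 on the whole range before its zero.\<close>

inductive_set bclose :: "'v set \<Rightarrow> ('v \<Rightarrow> nat) \<Rightarrow> ('v set \<Rightarrow> bool) \<Rightarrow> 'v set"
  for W :: "'v set" and \<theta> :: "'v \<Rightarrow> nat" and f :: "'v set \<Rightarrow> bool" where
  step: "v \<in> W \<Longrightarrow> finite U \<Longrightarrow> (\<And>u. u \<in> U \<Longrightarrow> u \<in> bclose W \<theta> f) \<Longrightarrow> (\<And>u. u \<in> U \<Longrightarrow> f {u, v})
           \<Longrightarrow> \<theta> v \<le> card U \<Longrightarrow> v \<in> bclose W \<theta> f"

abbreviation reduced_threshold :: "('v \<Rightarrow> nat) \<Rightarrow> 'v \<Rightarrow> ('v set \<Rightarrow> bool) \<Rightarrow> 'v \<Rightarrow> nat" where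
  "reduced_threshold \<theta> u f \<equiv> \<lambda>i. \<theta> i - of_bool (f {u, i})"

lemma bclose_subset: "bclose W \<theta> f \<subseteq> W"
  by (rule subsetI, erule bclose.cases) simp

lemma finite_bclose: "finite W \<Longrightarrow> finite (bclose W \<theta> f)"
  by (rule finite_subset[OF bclose_subset])

text \<open>Only edges with both ends in \<open>W\<close> matter, because the witnesses
  \<open>U\<close> lie in the closure and hence in \<open>W\<close>. This locality later makes the
  closure on \<open>W - {u}\<close> independent of the edges at \<open>u\<close>.\<close>

lemma bclose_mono_cong:
  assumes "\<And>v. v \<in> W \<Longrightarrow> \<theta> v = \<theta>' v" and "\<And>u v. u \<in> W \<Longrightarrow> v \<in> W \<Longrightarrow> f {u, v} = f' {u, v}"
  shows "bclose W \<theta> f \<subseteq> bclose W \<theta>' f'"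
proof
  fix v assume "v \<in> bclose W \<theta> f"
  then show "v \<in> bclose W \<theta>' f'"
  proof induction
    case (step v U)
    have "U \<subseteq> W" using step.IH bclose_subset[of W \<theta>' f'] by blast
    show ?case
    proof (rule bclose.step[of v W U])
      show "f' {u, v}" if "u \<in> U" for u
        using assms(2)[of u v] step.hyps(1) step.hyps(4)[OF that] subsetD[OF \<open>U \<subseteq> W\<close> that] by simp
      show "\<theta>' v \<le> card U" using step.hyps(5) assms(1)[OF step.hyps(1)] by simp
    qed (fact step.hyps(1) step.hyps(2) step.IH)+
  qed
qed

lemma bclose_cong:
  assumes "\<And>v. v \<in> W \<Longrightarrow> \<theta> v = \<theta>' v" and "\<And>u v. u \<in> W \<Longrightarrow> v \<in> W \<Longrightarrow> f {u, v} = f' {u, v}"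
  shows "bclose W \<theta> f = bclose W \<theta>' f'"
  using bclose_mono_cong[of W \<theta> \<theta>' f f'] bclose_mono_cong[of W \<theta>' \<theta> f' f] assms by auto

lemma bclose_eq_empty:
  assumes "\<And>v. v \<in> W \<Longrightarrow> \<theta> v \<noteq> 0"
  shows "bclose W \<theta> f = {}"
proof -
  have False if "v \<in> bclose W \<theta> f" for v
    using that
  proof induction
    case (step v U)
    then have "U = {}" by blast
    then show ?case using step.hyps(1,5) assms by simp
  qed
  then show ?thesis by blast
qed

lemma bclose_zero: "u \<in> W \<Longrightarrow> \<theta> u = 0 \<Longrightarrow> u \<in> bclose W \<theta> f"
  by (rule bclose.step[of u W "{}"]) auto

text \<open>The order of activation does not affect the closure, so any node of threshold 0 may be
  processed first. Its whole influence on the others is one unit of credit along each edge at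
  \<open>u\<close>; the smaller closure never looks at these edges again.\<close>

lemma bclose_insert:
  assumes u: "u \<in> W" "\<theta> u = 0"
  shows "bclose W \<theta> f = insert u (bclose (W - {u}) (reduced_threshold \<theta> u f) f)" (is "?L = insert u ?R")
proof (intro equalityI subsetI)
  fix v assume "v \<in> ?L"
  then show "v \<in> insert u ?R"
  proof induction
    case (step v U)
    show ?case
    proof (cases "v = u")
      case False
      \<comment> \<open>If \<open>u\<close> is among the witnesses, then \<open>f {u, v}\<close>
        holds, so the lost witness is matched by the lowered threshold.\<close>
      have "reduced_threshold \<theta> u f v \<le> card (U - {u})"
        using step.hyps(2,5) step.hyps(4)[of u] by (cases "u \<in> U") auto
      then have "v \<in> ?R"
        by (rule bclose.step[rotated 4]) (use False step.hyps(1,2,4) step.IH in auto)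
      then show ?thesis by (rule insertI2)
    qed auto
  qed
next
  fix v assume "v \<in> insert u ?R"
  moreover have "v \<in> ?L" if "v \<in> ?R" for v using that
  proof induction
    case (step v U)
    define U' where "U' = (if f {u, v} then insert u U else U)"
    have "u \<notin> U"
      using step.hyps bclose_subset[of "W - {u}" "reduced_threshold \<theta> u f" f] by blast
    then have "\<theta> v \<le> card U'" using step.hyps(2,5) by (auto simp: U'_def)
    show ?case
    proof (rule bclose.step[of v W U'])
      show "v \<in> W" "finite U'" "\<theta> v \<le> card U'"
        using step.hyps \<open>\<theta> v \<le> card U'\<close> by (simp_all add: U'_def)
    next
      fix x assume x: "x \<in> U'"
      show "x \<in> ?L"
        using x step.IH bclose_zero[of u W \<theta> f, OF u] by (cases "x = u") (simp_all add: U'_def split: if_splits)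
      show "f {x, v}"
        using x step.hyps(4) by (cases "x = u") (simp_all add: U'_def split: if_splits)
    qed
  qed
  ultimately show "v \<in> ?L" using bclose_zero[of u W \<theta> f] u by auto
qed

lemma card_bclose_insert:
  assumes "finite W" "u \<in> W" "\<theta> u = 0"
  shows "card (bclose W \<theta> f) = Suc (card (bclose (W - {u}) (reduced_threshold \<theta> u f) f))"
proof -
  have "u \<notin> bclose (W - {u}) (reduced_threshold \<theta> u f) f"
    using bclose_subset[of "W - {u}"] by auto
  then show ?thesis
    by (simp add: bclose_insert[of u W \<theta> f, OF assms(2,3)] finite_bclose assms(1))
qed

text \<open>The probability of at least \<open>t\<close> successes in \<open>j\<close> independent
  trials. The recursion conditions on one trial, which is what revealing the edge to one active node
  does; truncation in \<open>t - 1\<close> keeps a threshold that is already met at 0.\<close>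

fun binomial_tail :: "real \<Rightarrow> nat \<Rightarrow> nat \<Rightarrow> real" where
  "binomial_tail p 0 t = of_bool (t = 0)"
| "binomial_tail p (Suc j) t = (1 - p) * binomial_tail p j t + p * binomial_tail p j (t - 1)"

lemma binomial_tail_zero [simp]: "binomial_tail p j 0 = 1"
  by (induction j) (auto simp: algebra_simps)

lemma binomial_tail_bounds:
  assumes "0 \<le> p" "p \<le> 1"
  shows "0 \<le> binomial_tail p j t \<and> binomial_tail p j t \<le> 1"
proof (induction j arbitrary: t)
  case (Suc j)
  have "(1 - p) * binomial_tail p j t + p * binomial_tail p j (t - 1) \<le> (1 - p) * 1 + p * 1"
    using Suc assms by (intro add_mono mult_left_mono) auto
  then show ?case using Suc assms by auto
qed auto

text \<open>This is the union bound over the \<open>t\<close>-subsets of the trials, proved along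
  the recursion.\<close>

lemma binomial_tail_le:
  assumes "0 \<le> p" "p \<le> 1"
  shows "binomial_tail p j t \<le> (real j * p) ^ t / fact t"
proof (induction j arbitrary: t)
  case (Suc j)
  show ?case
  proof (cases t)
    case (Suc s)
    define x where "x = real j * p"
    have x: "0 \<le> x" using assms by (simp add: x_def)
    have "(1 - p) * binomial_tail p j t + p * binomial_tail p j s
            \<le> 1 * binomial_tail p j t + p * binomial_tail p j s"
      using assms binomial_tail_bounds[OF assms] by (intro add_mono mult_right_mono) auto
    also have "\<dots> \<le> x ^ Suc s / fact (Suc s) + p * (x ^ s / fact s)"
      using Suc.IH[of t] Suc.IH[of s] assms binomial_tail_bounds[OF assms]
      by (intro add_mono mult_mono) (auto simp: x_def Suc)
    also have "\<dots> = (x ^ Suc s + real (Suc s) * p * x ^ s) / fact (Suc s)"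
      by (simp add: divide_simps)
    \<comment> \<open>The left-hand side consists of the first two terms of the binomial expansion
      of the right-hand side.\<close>
    also have "x ^ Suc s + real (Suc s) * p * x ^ s \<le> (x + p) ^ Suc s"
    proof (induction s)
      case (Suc s)
      have "x ^ Suc (Suc s) + real (Suc (Suc s)) * p * x ^ Suc s
              \<le> (x + p) * (x ^ Suc s + real (Suc s) * p * x ^ s)"
        using x assms by (auto simp: algebra_simps)
      also have "\<dots> \<le> (x + p) * (x + p) ^ Suc s"
        using Suc x assms by (intro mult_left_mono) auto
      finally show ?case by simp
    qed auto
    finally show ?thesis by (simp add: Suc x_def algebra_simps divide_right_mono)
  qed auto
qed auto

text \<open>Keeps only the event of exactly \<open>t\<close> successes. Its factor
  \<open>(1 - p) ^ (j - t)\<close> is weakened to \<open>(1 - p) ^ j\<close>, which avoids a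
  subtraction in the exponent and costs little when \<open>j p\<close> is small.\<close>

lemma binomial_tail_ge:
  assumes "0 \<le> p" "p \<le> 1"
  shows "real (j choose t) * p ^ t * (1 - p) ^ j \<le> binomial_tail p j t"
proof (induction j arbitrary: t)
  case 0
  then show ?case by (cases t) auto
next
  case (Suc j)
  show ?case
  proof (cases t)
    case 0
    then show ?thesis using assms by (auto simp: power_le_one mult_le_one)
  next
    case (Suc s)
    have "p * (real (j choose s) * p ^ s * (1 - p) ^ j) * (1 - p) 
            \<le> p * (real (j choose s) * p ^ s * (1 - p) ^ j)"
      using assms by (intro mult_right_le_one_le) auto
    then have "real (Suc j choose t) * p ^ t * (1 - p) ^ Suc j \<le>
        (1 - p) * (real (j choose t) * p ^ t * (1 - p) ^ j) + p * (real (j choose s) * p ^ s * (1 - p) ^ j)"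
      by (simp add: Suc algebra_simps)
    also have "\<dots> \<le> (1 - p) * binomial_tail p j t + p * binomial_tail p j s"
      using Suc.IH assms by (intro add_mono mult_left_mono) auto
    finally show ?thesis using Suc by simp
  qed
qed

section \<open>Closures in random graphs\<close>

abbreviation random_edges :: "'e set \<Rightarrow> real \<Rightarrow> ('e \<Rightarrow> bool) pmf" where
  "random_edges E p \<equiv> Pi_pmf E False (\<lambda>_. bernoulli_pmf p)"

lemma expectation_prod_star:
  fixes h :: "'i \<Rightarrow> bool \<Rightarrow> real"
  assumes "finite I" "inj_on e I" "0 \<le> p" "p \<le> 1"
    and "\<And>i b. i \<in> I \<Longrightarrow> 0 \<le> h i b"
  shows "measure_pmf.expectation (random_edges (e ` I) p) (\<lambda>a. \<Prod>i\<in>I. h i (a (e i)))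
           = (\<Prod>i\<in>I. (1 - p) * h i False + p * h i True)"
proof -
  let ?h = "\<lambda>x. h (the_inv_into I e x)"
  have "measure_pmf.expectation (random_edges (e ` I) p) (\<lambda>a. \<Prod>i\<in>I. h i (a (e i)))
      = measure_pmf.expectation (random_edges (e ` I) p) (\<lambda>a. \<Prod>x\<in>e ` I. ?h x (a x))"
    by (simp add: prod.reindex[OF assms(2)] the_inv_into_f_f[OF assms(2)])
  also have "\<dots> = (\<Prod>x\<in>e ` I. measure_pmf.expectation (bernoulli_pmf p) (?h x))"
    using assms
    by (intro expectation_prod_Pi_pmf integrable_measure_pmf_finite) (auto simp: the_inv_into_f_f)
  also have "\<dots> = (\<Prod>i\<in>I. (1 - p) * h i False + p * h i True)"
    using assms(3,4)
    by (simp add: prod.reindex[OF assms(2)] the_inv_into_f_f[OF assms(2)] algebra_simps)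
  finally show ?thesis .
qed

text \<open>Conditioning on a star, whose edges are independent of the others. For each outcome
  \<open>X\<close> of the star, \<open>P\<close> forces an event \<open>Q X\<close> of the remaining
  edges, and a bound on \<open>Q X\<close> that is a product over the star integrates factor by
  factor.\<close>

lemma prob_random_edges_star:
  fixes h :: "'i \<Rightarrow> bool \<Rightarrow> real" and e :: "'i \<Rightarrow> 'e"
  assumes fin: "finite E" "finite I" and e: "inj_on e I" "e ` I \<subseteq> E" and p: "0 \<le> p" "p \<le> 1" and c: "0 \<le> c"
    and h: "\<And>i b. i \<in> I \<Longrightarrow> 0 \<le> h i b"
    and Q: "\<And>X. measure_pmf.prob (random_edges (E - e ` I) p) {g. Q X g} \<le> c * (\<Prod>i\<in>I. h i (X i))"
    and P: "\<And>X f g. P f \<Longrightarrow> (\<And>x. x \<notin> e ` I \<Longrightarrow> g x = f x) \<Longrightarrow> (\<And>i. i \<in> I \<Longrightarrow> X i = f (e i))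
              \<Longrightarrow> Q X g"
  shows "measure_pmf.prob (random_edges E p) {f. P f}
           \<le> c * (\<Prod>i\<in>I. (1 - p) * h i False + p * h i True)"
proof -
  let ?S = "e ` I"
  let ?m = "\<lambda>a g x. if x \<in> ?S then a x else g x"
  let ?A = "random_edges ?S p" and ?B = "random_edges (E - ?S) p"
  have "random_edges E p = random_edges (?S \<union> (E - ?S)) p"
    using e(2) by (simp add: Un_absorb1)
  also have "\<dots> = map_pmf (\<lambda>(a, g). ?m a g) (pair_pmf ?A ?B)"
    using fin by (subst Pi_pmf_union) auto
  also have "\<dots> = bind_pmf ?A (\<lambda>a. map_pmf (?m a) ?B)"
    by (simp add: pair_pmf_def map_pmf_def bind_assoc_pmf bind_return_pmf)
  finally have "emeasure (random_edges E p) {f. P f}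
      = (\<integral>\<^sup>+a. emeasure ?B {g. P (?m a g)} \<partial>?A)"
    by (simp add: emeasure_bind_pmf vimage_def)
  also have "\<dots> \<le> (\<integral>\<^sup>+a. ennreal (c * (\<Prod>i\<in>I. h i (a (e i)))) \<partial>?A)"
  proof (intro nn_integral_mono)
    fix a
    have "{g. P (?m a g)} \<subseteq> {g. Q (\<lambda>i. a (e i)) g}"
      by (auto intro: P)
    then have "emeasure ?B {g. P (?m a g)} \<le> emeasure ?B {g. Q (\<lambda>i. a (e i)) g}"
      by (intro emeasure_mono) auto
    also have "\<dots> \<le> ennreal (c * (\<Prod>i\<in>I. h i (a (e i))))"
      using Q[of "\<lambda>i. a (e i)"] by (simp add: measure_pmf.emeasure_eq_measure ennreal_leI)
    finally show "emeasure ?B {g. P (?m a g)} \<le> \<dots>" .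
  qed
  also have "\<dots> = ennreal (measure_pmf.expectation ?A (\<lambda>a. c * (\<Prod>i\<in>I. h i (a (e i)))))"
  proof (intro nn_integral_eq_integral integrable_measure_pmf_finite AE_I2)
    show "finite (set_pmf ?A)"
      using fin by (simp add: set_Pi_pmf finite_PiE_dflt)
  qed (use c h in \<open>auto intro!: mult_nonneg_nonneg prod_nonneg\<close>)
  also have "\<dots> = ennreal (c * (\<Prod>i\<in>I. (1 - p) * h i False + p * h i True))"
    using expectation_prod_star[OF fin(2) e(1) p, of h] h by simp
  finally show ?thesis
    using c h p
    by (simp add: measure_pmf.emeasure_eq_measure ennreal_le_iff prod_nonneg)
qed


lemma inj_on_edge: "u \<notin> W \<Longrightarrow> inj_on (\<lambda>i. {u, i}) W"
  by (auto simp: inj_on_def doubleton_eq_iff)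

lemma not_in_star:
  assumes "x \<noteq> u" "y \<noteq> u"
  shows "{x, y} \<notin> (\<lambda>i. {u, i}) ` I"
proof
  assume "{x, y} \<in> (\<lambda>i. {u, i}) ` I"
  then obtain i where "{x, y} = {u, i}" by (rule imageE)
  with assms show False by (simp add: doubleton_eq_iff)
qed

lemma edges_minus_star:
  assumes "{{x, y} |x y. x \<in> W \<and> y \<in> W \<and> x \<noteq> y} \<subseteq> E" and "u \<in> W"
  shows "(\<lambda>i. {u, i}) ` (W - {u}) \<subseteq> E"
    and "{{x, y} |x y. x \<in> W - {u} \<and> y \<in> W - {u} \<and> x \<noteq> y} \<subseteq> E - (\<lambda>i. {u, i}) ` I"
  using assms by (auto simp: doubleton_eq_iff)

text \<open>The factor of one vertex in the expectation of \<open>l\<close> to the power \<open>N\<close>, where \<open>N\<close> is the number of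
  vertices whose threshold is reached by independent binomial variables with \<open>j\<close> trials. Markov's
  inequality for this expectation is what the bounds on closure sizes amount to: revealing the edges
  at an active vertex reduces \<open>j\<close> by one and feeds each other vertex one trial.\<close>

definition tail_weight :: "real \<Rightarrow> real \<Rightarrow> nat \<Rightarrow> nat \<Rightarrow> real" where
  "tail_weight p l j t = 1 + (l - 1) * binomial_tail p j t"

lemma tail_weight_step:
  "(1 - p) * tail_weight p l j t + p * tail_weight p l j (t - 1) = tail_weight p l (Suc j) t"
  by (simp add: tail_weight_def algebra_simps)

lemma tail_weight_zero [simp]: "tail_weight p l j 0 = l"
  by (simp add: tail_weight_def)

lemma tail_weight_nonneg:
  assumes "0 \<le> p" "p \<le> 1" "0 < l"
  shows "0 \<le> tail_weight p l j t"
proof -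
  have "0 \<le> (1 - binomial_tail p j t) + l * binomial_tail p j t"
    using assms binomial_tail_bounds[of p j t] by auto
  then show ?thesis by (simp add: tail_weight_def algebra_simps)
qed

lemma tail_weight_ge_1:
  assumes "0 \<le> p" "p \<le> 1" "1 \<le> l"
  shows "1 \<le> tail_weight p l j t"
  using assms binomial_tail_bounds[of p j t] by (auto simp: tail_weight_def)

text \<open>The common induction step of the next two lemmas; \<open>R\<close> is the condition on
  the size that remains after removing \<open>u\<close>. The factor of \<open>u\<close> in the
  product is \<open>l\<close> because its threshold is 0, and this pays for the additional
  \<open>l\<close> in the denominator.\<close>

lemma prob_reveal_star:
  fixes W :: "'v set"
  assumes "finite W" "finite E" "{{x, y} |x y. x \<in> W \<and> y \<in> W \<and> x \<noteq> y} \<subseteq> E" "u \<in> W" "\<theta> u = 0"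
    and p: "0 \<le> p" "p \<le> 1" "0 < l"
    and IH: "\<And>\<theta>'. measure_pmf.prob (random_edges (E - (\<lambda>i. {u, i}) ` (W - {u})) p)
                 {f. R (card (bclose (W - {u}) \<theta>' f))}
               \<le> (\<Prod>i\<in>W - {u}. tail_weight p l j (\<theta>' i)) / l ^ j"
  shows "measure_pmf.prob (random_edges E p) {f. \<exists>s. card (bclose W \<theta> f) = Suc s \<and> R s}
               \<le> (\<Prod>i\<in>W. tail_weight p l (Suc j) (\<theta> i)) / l ^ Suc j"
proof -
  have "measure_pmf.prob (random_edges E p) {f. \<exists>s. card (bclose W \<theta> f) = Suc s \<and> R s}
      \<le> 1 / l ^ j * (\<Prod>i\<in>W - {u}. (1 - p) * tail_weight p l j (\<theta> i - of_bool False)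
                                    + p * tail_weight p l j (\<theta> i - of_bool True))"
  proof (rule prob_random_edges_star[where e = "\<lambda>i. {u, i}"
        and Q = "\<lambda>X g. R (card (bclose (W - {u}) (\<lambda>i. \<theta> i - of_bool (X i)) g))"])
    show "measure_pmf.prob (random_edges (E - (\<lambda>i. {u, i}) ` (W - {u})) p)
            {g. R (card (bclose (W - {u}) (\<lambda>i. \<theta> i - of_bool (X i)) g))}
          \<le> 1 / l ^ j * (\<Prod>i\<in>W - {u}. tail_weight p l j (\<theta> i - of_bool (X i)))" for X
      using IH[of "\<lambda>i. \<theta> i - of_bool (X i)"] by simp
  next
    fix X :: "'v \<Rightarrow> bool" and f g
    assume f: "\<exists>s. card (bclose W \<theta> f) = Suc s \<and> R s"
      and g: "\<And>x. x \<notin> (\<lambda>i. {u, i}) ` (W - {u}) \<Longrightarrow> g x = f x"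
      and X: "\<And>i. i \<in> W - {u} \<Longrightarrow> X i = f {u, i}"
    have "g {x, y} = f {x, y}" if "x \<noteq> u" "y \<noteq> u" for x y
      using that by (intro g not_in_star)
    then have "bclose (W - {u}) (\<lambda>i. \<theta> i - of_bool (X i)) g = bclose (W - {u}) (reduced_threshold \<theta> u f) f"
      using X by (intro bclose_cong) simp_all
    then show "R (card (bclose (W - {u}) (\<lambda>i. \<theta> i - of_bool (X i)) g))"
      using f card_bclose_insert[of W u \<theta> f] assms(1,4,5) by auto
  qed (use assms(1,2) p edges_minus_star(1)[OF assms(3,4)] inj_on_edge[of u "W - {u}"] in
        \<open>auto intro: tail_weight_nonneg\<close>)
  also have "\<dots> = (\<Prod>i\<in>W. tail_weight p l (Suc j) (\<theta> i)) / l ^ Suc j"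
    using p(3) by (simp add: tail_weight_step[unfolded One_nat_def] prod.remove[OF assms(1,4)] assms(5))
  finally show ?thesis .
qed

text \<open>If the exploration ends after exactly \<open>j\<close> nodes, then the \<open>j\<close>
  revealed stars have met the thresholds of exactly \<open>j\<close> nodes, and Markov's inequality
  applies for any \<open>l > 0\<close>. With \<open>l < 1\<close> it penalises stopping too early.
  \<open>E\<close> is general because the induction deletes stars from it.\<close>

lemma prob_card_bclose_eq:
  assumes "finite W" "finite E" "{{x, y} |x y. x \<in> W \<and> y \<in> W \<and> x \<noteq> y} \<subseteq> E"
    and p: "0 \<le> p" "p \<le> 1" "0 < l"
  shows "measure_pmf.prob (random_edges E p) {f. card (bclose W \<theta> f) = j}
           \<le> (\<Prod>i\<in>W. tail_weight p l j (\<theta> i)) / l ^ j"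
  using assms(1-3)
proof (induction j arbitrary: W E \<theta>)
  case 0
  show ?case
  \<comment> \<open>A node of threshold 0 excludes size 0. Without one, all weights for zero trials
    are 1 and the bound is trivial.\<close>
  proof (cases "\<exists>u\<in>W. \<theta> u = 0")
    case True
    then obtain u where "u \<in> W" "\<theta> u = 0" by blast
    then have "bclose W \<theta> f \<noteq> {}" for f
      using bclose_zero[of u W \<theta> f] by blast
    then have "{f. card (bclose W \<theta> f) = 0} = {}"
      using 0 by (simp add: finite_bclose)
    then show ?thesis using p by (simp only:) (simp add: prod_nonneg tail_weight_nonneg)
  next
    case False
    then have "tail_weight p l 0 (\<theta> i) = 1" if "i \<in> W" for i
      using that by (auto simp: tail_weight_def)
    then show ?thesis by simp
  qed
next
  case (Suc j)
  show ?case
  proof (cases "\<exists>u\<in>W. \<theta> u = 0")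
    case True
    then obtain u where u: "u \<in> W" "\<theta> u = 0" by blast
    have "measure_pmf.prob (random_edges E p) {f. \<exists>s. card (bclose W \<theta> f) = Suc s \<and> s = j}
        \<le> (\<Prod>i\<in>W. tail_weight p l (Suc j) (\<theta> i)) / l ^ Suc j"
      by (rule prob_reveal_star[where R = "\<lambda>s. s = j"])
        (use Suc.prems p u in \<open>auto intro!: Suc.IH edges_minus_star(2)\<close>)
    then show ?thesis by simp
  next
    case False
    then have "{f. card (bclose W \<theta> f) = Suc j} = {}"
      by (auto simp: bclose_eq_empty)
    then show ?thesis using p by (simp add: prod_nonneg tail_weight_nonneg)
  qed
qed

text \<open>For \<open>l \<ge> 1\<close>, Markov's inequality covers all sizes from \<open>j\<close>
  on at once, so no sum over sizes is required.\<close>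

lemma prob_card_bclose_ge:
  assumes "finite W" "finite E" "{{x, y} |x y. x \<in> W \<and> y \<in> W \<and> x \<noteq> y} \<subseteq> E"
    and p: "0 \<le> p" "p \<le> 1" "1 \<le> l"
  shows "measure_pmf.prob (random_edges E p) {f. j \<le> card (bclose W \<theta> f)}
           \<le> (\<Prod>i\<in>W. tail_weight p l j (\<theta> i)) / l ^ j"
  using assms(1-3)
proof (induction j arbitrary: W E \<theta>)
  case 0
  \<comment> \<open>The event is certain here, so the bound must be at least 1; it is, since
    \<open>1 \<le> l\<close> makes every weight at least 1.\<close>
  have "1 \<le> (\<Prod>i\<in>W. tail_weight p l 0 (\<theta> i))"
    using p by (intro prod_ge_1 tail_weight_ge_1)
  then show ?case by simp
next
  case (Suc j)
  show ?case
  proof (cases "\<exists>u\<in>W. \<theta> u = 0")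
    case True
    then obtain u where u: "u \<in> W" "\<theta> u = 0" by blast
    have "measure_pmf.prob (random_edges E p) {f. \<exists>s. card (bclose W \<theta> f) = Suc s \<and> j \<le> s}
        \<le> (\<Prod>i\<in>W. tail_weight p l (Suc j) (\<theta> i)) / l ^ Suc j"
      by (rule prob_reveal_star[where R = "\<lambda>s. j \<le> s"])
        (use Suc.prems p u in \<open>auto intro!: Suc.IH edges_minus_star(2)\<close>)
    moreover have "(\<exists>s. card (bclose W \<theta> f) = Suc s \<and> j \<le> s) \<longleftrightarrow> Suc j \<le> card (bclose W \<theta> f)" for f
      by (cases "card (bclose W \<theta> f)") auto
    ultimately show ?thesis by simp
  next
    case False
    then have "{f. Suc j \<le> card (bclose W \<theta> f)} = {}"
      by (auto simp: bclose_eq_empty)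
    then show ?thesis using p by (simp add: prod_nonneg tail_weight_nonneg)
  qed
qed


text \<open>The vertices on which the colour with seeds \<open>R\<close> is unaffected by the set \<open>K\<close> of vertices
  that the other colour can reach; a vertex with threshold \<open>r\<close> has no revealed neighbour of the
  other colour.\<close>

definition clean :: "'v set \<Rightarrow> 'v set \<Rightarrow> nat \<Rightarrow> ('v \<Rightarrow> nat) \<Rightarrow> ('v set \<Rightarrow> bool) \<Rightarrow> 'v set \<Rightarrow> 'v set" where
  "clean W R r \<theta> f K = {i \<in> W - K. i \<in> R \<or> (\<theta> i = r \<and> (\<forall>u\<in>K. \<not> f {u, i}))}"

text \<open>A threshold equal to \<open>r\<close> records that no neighbour in \<open>K\<close> has
  been revealed: thresholds start at most \<open>r\<close> and only decrease, so one edge to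
  \<open>u\<close> moves them away from \<open>r\<close> for good. \<open>0 < r\<close> keeps the
  truncated subtraction from hiding such an edge.\<close>

lemma clean_insert:
  assumes "u \<notin> R" "0 < r" "\<And>i. i \<in> W - R \<Longrightarrow> \<theta> i \<le> r"
  shows "clean W R r \<theta> f (insert u K) = clean (W - {u}) R r (reduced_threshold \<theta> u f) f K"
proof -
  have "(\<theta> i - of_bool (f {u, i}) = r) \<longleftrightarrow> \<theta> i = r \<and> \<not> f {u, i}" if "i \<in> W - R" for i
    using assms(2) assms(3)[OF that] by auto
  then show ?thesis
    unfolding clean_def using assms(1) by (intro Collect_cong) blast
qed

text \<open>Revealing \<open>K\<close> leaves the edges between clean vertices untouched, and a vertex stays clean
  with probability \<open>1 - p\<close> at each of the \<open>k\<close> steps.\<close>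

lemma prob_card_blocked_bclose_eq:
  fixes W :: "'v set"
  assumes "finite W" "finite E" "{{x, y} |x y. x \<in> W \<and> y \<in> W \<and> x \<noteq> y} \<subseteq> E"
    and "R \<subseteq> W" "\<And>i. i \<in> W - R \<Longrightarrow> \<theta> i \<le> r"
    and p: "0 \<le> p" "p \<le> 1" "0 < l" "l \<le> 1" and r: "0 < r"
  shows "measure_pmf.prob (random_edges E p)
           {f. card (bclose (W - R) \<theta> f) = k \<and>
               card (bclose (clean W R r \<theta> f (bclose (W - R) \<theta> f)) (\<lambda>i. if i \<in> R then 0 else r) f) = j}
         \<le> l ^ card R / l ^ j *
             (\<Prod>i\<in>W - R. if \<theta> i = r then 1 - (1 - l) * binomial_tail p j r * (1 - p) ^ k else 1)"
  using assms(1-5)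
proof (induction k arbitrary: W E \<theta>)
  case (0 W E \<theta>)
  \<comment> \<open>With nothing reachable, the clean nodes are \<open>R\<close> and the nodes still
    at threshold \<open>r\<close>, and the edges among them are unrevealed.\<close>
  let ?W = "clean W R r \<theta> (\<lambda>_. False) {}" and ?\<rho> = "\<lambda>i. if i \<in> R then 0 else r"
  have fin: "finite (W - R)" using 0 by auto
  have "measure_pmf.prob (random_edges E p)
           {f. card (bclose (W - R) \<theta> f) = 0 \<and>
               card (bclose (clean W R r \<theta> f (bclose (W - R) \<theta> f)) ?\<rho> f) = j}
        \<le> measure_pmf.prob (random_edges E p) {f. card (bclose ?W ?\<rho> f) = j}"
    using fin by (intro measure_pmf.finite_measure_mono) (auto simp: finite_bclose clean_def)
  also have "\<dots> \<le> (\<Prod>i\<in>?W. tail_weight p l j (?\<rho> i)) / l ^ j"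
    using 0 p by (intro prob_card_bclose_eq) (auto simp: clean_def)
  also have "?W = R \<union> {i \<in> W - R. \<theta> i = r}"
    using 0 by (auto simp: clean_def)
  also have "(\<Prod>i\<in>\<dots>. tail_weight p l j (?\<rho> i))
      = (\<Prod>i\<in>R. tail_weight p l j (?\<rho> i)) * (\<Prod>i\<in>{i \<in> W - R. \<theta> i = r}. tail_weight p l j (?\<rho> i))"
    using 0 by (intro prod.union_disjoint) (auto intro: finite_subset)
  also have "(\<Prod>i\<in>R. tail_weight p l j (?\<rho> i)) = l ^ card R" by simp
  also have "(\<Prod>i\<in>{i \<in> W - R. \<theta> i = r}. tail_weight p l j (?\<rho> i))
      = (\<Prod>i\<in>W - R. if \<theta> i = r then tail_weight p l j (?\<rho> i) else 1)"
    by (rule prod.inter_filter[OF fin])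
  also have "\<dots> = (\<Prod>i\<in>W - R. if \<theta> i = r then 1 - (1 - l) * binomial_tail p j r else 1)"
    by (intro prod.cong) (auto simp: tail_weight_def algebra_simps)
  finally show ?case by (simp only: power_0 mult_1_right times_divide_eq_left)
next
  case (Suc k W E \<theta>)
  let ?\<rho> = "\<lambda>i. if i \<in> R then 0 else r"
  let ?b = "\<lambda>k. 1 - (1 - l) * binomial_tail p j r * (1 - p) ^ k"
  have b: "0 \<le> ?b k \<and> ?b k \<le> 1" for k
    using p binomial_tail_bounds[of p j r]
    by (auto intro!: mult_le_one mult_nonneg_nonneg power_le_one)
  define P where "P W \<theta> k f \<longleftrightarrow> card (bclose (W - R) \<theta> f) = k \<and>
      card (bclose (clean W R r \<theta> f (bclose (W - R) \<theta> f)) ?\<rho> f) = j" for W \<theta> k f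
  show ?case
  proof (cases "\<exists>u\<in>W - R. \<theta> u = 0")
    case True
    then obtain u where u: "u \<in> W - R" "\<theta> u = 0" by blast
    let ?I = "W - {u} - R"
    \<comment> \<open>A revealed edge to \<open>u\<close> takes a node out of the clean set, so its
      factor becomes 1.\<close>
    let ?h = "\<lambda>i b. if \<theta> i - of_bool b = r then ?b k else 1"
    have step: "P (W - {u}) (reduced_threshold \<theta> u f) k f" if "P W \<theta> (Suc k) f" for f
    proof -
      have "W - R - {u} = ?I" by blast
      moreover have "clean W R r \<theta> f (insert u (bclose ?I (reduced_threshold \<theta> u f) f))
          = clean (W - {u}) R r (reduced_threshold \<theta> u f) f (bclose ?I (reduced_threshold \<theta> u f) f)"
        using u Suc.prems(5) r by (intro clean_insert) auto
      ultimately show ?thesis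
        using that bclose_insert[of u "W - R" \<theta> f, OF u] card_bclose_insert[of "W - R" u \<theta> f] u Suc.prems(1)
        by (simp add: P_def)
    qed
    have "measure_pmf.prob (random_edges E p) {f. P W \<theta> (Suc k) f}
        \<le> l ^ card R / l ^ j * (\<Prod>i\<in>?I. (1 - p) * ?h i False + p * ?h i True)"
    proof (rule prob_random_edges_star[where e = "\<lambda>i. {u, i}"
          and Q = "\<lambda>X. P (W - {u}) (\<lambda>i. \<theta> i - of_bool (X i)) k"])
      show "measure_pmf.prob (random_edges (E - (\<lambda>i. {u, i}) ` ?I) p)
              {g. P (W - {u}) (\<lambda>i. \<theta> i - of_bool (X i)) k g}
            \<le> l ^ card R / l ^ j * (\<Prod>i\<in>?I. ?h i (X i))" for X
        unfolding P_def using Suc.prems u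
        by (intro Suc.IH edges_minus_star(2)) (auto intro: le_trans[OF diff_le_self])
    next
      fix X :: "'v \<Rightarrow> bool" and f g
      assume f: "P W \<theta> (Suc k) f"
        and g: "\<And>x. x \<notin> (\<lambda>i. {u, i}) ` ?I \<Longrightarrow> g x = f x"
        and X: "\<And>i. i \<in> ?I \<Longrightarrow> X i = f {u, i}"
      have g': "g {x, y} = f {x, y}" if "x \<noteq> u" "y \<noteq> u" for x y
        using that by (intro g not_in_star)
      let ?\<theta>X = "\<lambda>i. \<theta> i - of_bool (X i)" and ?\<theta>f = "reduced_threshold \<theta> u f"
      have K: "bclose ?I ?\<theta>X g = bclose ?I ?\<theta>f f"
        by (intro bclose_cong) (simp_all add: X g')
      have "bclose ?I ?\<theta>f f \<subseteq> - {u}"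
        using bclose_subset[of ?I ?\<theta>f f] by blast
      then have C: "clean (W - {u}) R r ?\<theta>X g (bclose ?I ?\<theta>f f) = clean (W - {u}) R r ?\<theta>f f (bclose ?I ?\<theta>f f)"
        unfolding clean_def by (intro Collect_cong) (auto simp: X g' subset_iff)
      have "bclose (clean (W - {u}) R r ?\<theta>f f (bclose ?I ?\<theta>f f)) ?\<rho> g
          = bclose (clean (W - {u}) R r ?\<theta>f f (bclose ?I ?\<theta>f f)) ?\<rho> f"
        by (intro bclose_cong) (auto simp: clean_def g')
      with step[OF f] show "P (W - {u}) ?\<theta>X k g"
        by (simp add: P_def K C)
    next
      show "inj_on (\<lambda>i. {u, i}) ?I" by (intro inj_on_edge) auto
      show "(\<lambda>i. {u, i}) ` ?I \<subseteq> E" using Suc.prems(3) u by auto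
    qed (use Suc.prems p b in auto)
    also have "\<dots> \<le> l ^ card R / l ^ j * (\<Prod>i\<in>?I. if \<theta> i = r then ?b (Suc k) else 1)"
    proof (rule mult_left_mono[OF prod_mono])
      fix i assume i: "i \<in> ?I"
      have nn: "0 \<le> (1 - p) * ?h i False + p * ?h i True" using p b by auto
      have "\<theta> i \<le> r" using Suc.prems(5) i by auto
      \<comment> \<open>For \<open>\<theta> i = r\<close> this is
        \<open>(1 - p) * ?b k + p = ?b (Suc k)\<close>: one more step multiplies the chance of
        staying clean by \<open>1 - p\<close>. Below \<open>r\<close> both sides are 1.\<close>
      then have "(1 - p) * ?h i False + p * ?h i True \<le> (if \<theta> i = r then ?b (Suc k) else 1)"
        using r by (auto simp: algebra_simps)
      with nn show "0 \<le> (1 - p) * ?h i False + p * ?h i True \<and>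
          (1 - p) * ?h i False + p * ?h i True \<le> (if \<theta> i = r then ?b (Suc k) else 1)"
        by (rule conjI)
    qed (use p in simp)
    also have "(\<Prod>i\<in>?I. if \<theta> i = r then ?b (Suc k) else 1)
        = (\<Prod>i\<in>W - R. if \<theta> i = r then ?b (Suc k) else 1)"
    proof -
      have "W - R - {u} = ?I" by blast
      then show ?thesis using u r Suc.prems(1) by (simp add: prod.remove[of "W - R" u])
    qed
    finally show ?thesis by (simp only: P_def)
  next
    case False
    then have "bclose (W - R) \<theta> f = {}" for f
      by (intro bclose_eq_empty) auto
    then have "\<not> P W \<theta> (Suc k) f" for f
      by (simp add: P_def)
    then have "measure_pmf.prob (random_edges E p) {f. P W \<theta> (Suc k) f} = 0"
      by simp
    moreover have "0 \<le> (\<Prod>i\<in>W - R. if \<theta> i = r then ?b (Suc k) else 1)"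
      using b[of "Suc k"] by (intro prod_nonneg) auto
    ultimately have "measure_pmf.prob (random_edges E p) {f. P W \<theta> (Suc k) f} \<le>
        l ^ card R / l ^ j * (\<Prod>i\<in>W - R. if \<theta> i = r then ?b (Suc k) else 1)"
      using p by simp
    then show ?thesis unfolding P_def .
  qed
qed

section \<open>The competing process\<close>

definition reach :: "nat \<Rightarrow> nat \<Rightarrow> nat set set \<Rightarrow> nat set \<Rightarrow> nat set \<Rightarrow> nat set" where
  "reach n r G A B = bclose ({1..n} - B) (\<lambda>i. if i \<in> A then 0 else r) (\<lambda>e. e \<in> G)"

definition safe :: "nat \<Rightarrow> nat \<Rightarrow> nat set set \<Rightarrow> nat set \<Rightarrow> nat set \<Rightarrow> nat set" where
  "safe n r G A B =
     bclose (clean {1..n} A r (\<lambda>i. if i \<in> B then 0 else r) (\<lambda>e. e \<in> G) (reach n r G B A))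
       (\<lambda>i. if i \<in> A then 0 else r) (\<lambda>e. e \<in> G)"

fun seeds_of :: "nat set \<times> nat set \<Rightarrow> colour \<Rightarrow> nat set" where
  "seeds_of s Red = fst s"
| "seeds_of s Black = snd s"
| "seeds_of s White = {}"

text \<open>The invariant of the process. It bounds each colour from above; for the other colour,
  together with the terminal condition, it also yields the bound from below.\<close>

definition consistent :: "nat \<Rightarrow> nat \<Rightarrow> nat set set \<Rightarrow> nat set \<times> nat set \<Rightarrow> (nat \<Rightarrow> colour) \<Rightarrow> bool" where
  "consistent n r G s c \<longleftrightarrow> (\<forall>S\<in>{Red, Black}.
     (\<forall>v\<in>{1..n}. c v = S \<longrightarrow> v \<in> reach n r G (seeds_of s S) (seeds_of s (opposite S))) \<and>
     (\<forall>v\<in>seeds_of s S. c v = S))"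

declare colouring_at.simps [simp del]

lemma consistent_initial:
  assumes "fst s \<inter> snd s = {}"
  shows "consistent n r G s (initial_colouring s)"
  using assms
  by (auto simp: consistent_def initial_colouring_def reach_def intro!: bclose_zero split: if_splits)

lemma threshold_reach:
  assumes c: "consistent n r G s c" and S: "S \<in> {Red, Black}"
    and v: "v \<in> {1..n}" "c v = White" "threshold n r G c S v"
  shows "v \<in> reach n r G (seeds_of s S) (seeds_of s (opposite S))"
proof -
  define U where "U = {u \<in> {1..n}. {u, v} \<in> G \<and> c u = S}"
  have "opposite S \<in> {Red, Black}" using S by auto
  then have "v \<notin> seeds_of s (opposite S)" using c v(2) by (fastforce simp: consistent_def)
  moreover have "r \<le> card U"
    using v(3) by (simp add: threshold_def coloured_neighbours_def U_def)
  moreover have "u \<in> reach n r G (seeds_of s S) (seeds_of s (opposite S))" if "u \<in> U" for u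
    using that c S unfolding consistent_def U_def by blast
  ultimately show ?thesis
    unfolding reach_def using v(1)
    by (intro bclose.step[of v _ U]) (simp_all add: U_def)
qed

text \<open>The argument is node by node and refers only to the colouring \<open>c\<close> before
  the step, so simultaneous rings of several clocks are covered too.\<close>

lemma consistent_ring_step:
  assumes c: "consistent n r G s c"
  shows "consistent n r G s (ring_step n r G \<xi> t c)"
proof -
  have "ring_step n r G \<xi> t c v = c v \<or>
      (v \<in> {1..n} \<and> c v = White \<and> ring_step n r G \<xi> t c v \<in> {Red, Black} \<and>
       threshold n r G c (ring_step n r G \<xi> t c v) v)" for v
    by (auto simp: ring_step_def)
  then have *: "ring_step n r G \<xi> t c v = c v \<or> (c v = White \<and> ring_step n r G \<xi> t c v \<in> {Red, Black} \<and>
      v \<in> reach n r G (seeds_of s (ring_step n r G \<xi> t c v)) (seeds_of s (opposite (ring_step n r G \<xi> t c v))))" for v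
    using threshold_reach[OF c] by metis
  show ?thesis
    unfolding consistent_def
  proof (intro ballI conjI impI)
    fix S v assume S: "S \<in> {Red, Black}" "v \<in> {1..n}" "ring_step n r G \<xi> t c v = S"
    then show "v \<in> reach n r G (seeds_of s S) (seeds_of s (opposite S))"
      using *[of v] c by (auto simp: consistent_def)
  next
    fix S v assume S: "S \<in> {Red, Black}" "v \<in> seeds_of s S"
    then have "c v = S" using c by (auto simp: consistent_def)
    then show "ring_step n r G \<xi> t c v = S" using *[of v] S by auto
  qed
qed

lemma consistent_colouring_at:
  assumes "fst s \<inter> snd s = {}"
  shows "consistent n r G s (colouring_at n r (G, s, \<xi>) t)"
proof -
  have "consistent n r G s (fold (ring_step n r G \<xi>) ts c)" if "consistent n r G s c" for ts c
    using that by (induction ts arbitrary: c) (simp_all add: consistent_ring_step)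
  then show ?thesis by (simp add: colouring_at.simps consistent_initial[OF assms])
qed

text \<open>No induction over time: along the closure, a clean node outside the seeds has at least
  \<open>r\<close> neighbours of colour \<open>S\<close> and none of the opposite colour, so it
  meets the threshold and cannot be white in a terminal colouring.\<close>

lemma safe_subset_coloured:
  assumes c: "consistent n r G s c" and S: "S \<in> {Red, Black}" and "0 < r"
    and stopped: "terminal n r G c"
  shows "safe n r G (seeds_of s S) (seeds_of s (opposite S)) \<subseteq> {v \<in> {1..n}. c v = S}"
proof
  let ?A = "seeds_of s S" and ?B = "seeds_of s (opposite S)"
  let ?K = "reach n r G ?B ?A"
  let ?W = "clean {1..n} ?A r (\<lambda>i. if i \<in> ?B then 0 else r) (\<lambda>e. e \<in> G) ?K"
  have opp: "opposite S \<in> {Red, Black}" "opposite (opposite S) = S" using S by auto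
  have K: "u \<in> ?K" if "u \<in> {1..n}" "c u = opposite S" for u
    using c opp that by (auto simp: consistent_def)
  fix v assume "v \<in> safe n r G ?A ?B"
  then show "v \<in> {v \<in> {1..n}. c v = S}"
    unfolding safe_def
  proof induction
    case (step v U)
    have v: "v \<in> {1..n}" "v \<notin> ?K" using step.hyps(1) by (auto simp: clean_def)
    show ?case
    proof (cases "v \<in> ?A")
      case True
      then show ?thesis using c S v by (auto simp: consistent_def)
    next
      case False
      then have no: "\<forall>u\<in>?K. {u, v} \<notin> G" using step.hyps(1) by (auto simp: clean_def)
      have "U \<subseteq> {u \<in> {1..n}. {u, v} \<in> G \<and> c u = S}"
        using step.IH step.hyps(4) by blast
      then have "card U \<le> coloured_neighbours n G c S v"
        unfolding coloured_neighbours_def by (intro card_mono) auto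
      moreover have "r \<le> card U" using step.hyps(5) False by simp
      moreover have "{u \<in> {1..n}. {u, v} \<in> G \<and> c u = opposite S} = {}"
        using no K by blast
      then have "coloured_neighbours n G c (opposite S) v = 0"
        unfolding coloured_neighbours_def by (simp only: card.empty)
      ultimately have "threshold n r G c S v" by (simp add: threshold_def)
      then have "c v \<noteq> White" using stopped v(1) S by (auto simp: terminal_def)
      moreover have "c v \<noteq> opposite S" using K v by blast
      ultimately have "c v = S" using S by (cases "c v") auto
      with v show ?thesis by blast
    qed
  qed
qed

section \<open>Termination of the process when the ring times tend to infinity\<close>

definition rings :: "nat \<Rightarrow> (nat \<Rightarrow> nat \<Rightarrow> real) \<Rightarrow> real set" where
  "rings n \<xi> = {s. \<exists>v\<in>{1..n}. \<exists>k. ring_time \<xi> v k = s}"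

lemma colouring_at_rings:
  "colouring_at n r (G, s, \<xi>) t =
     fold (ring_step n r G \<xi>) (sorted_list_of_set (rings n \<xi> \<inter> {..t})) (initial_colouring s)"
  by (auto simp: colouring_at.simps rings_def intro!: arg_cong[of _ _ "\<lambda>A. fold _ (sorted_list_of_set A) _"])

text \<open>Two consequences are used: finitely many rings up to each time, so that
  \<open>sorted_list_of_set\<close> really lists them, and a further ring of every clock after each
  time.\<close>

definition tame :: "nat \<Rightarrow> (nat \<Rightarrow> nat \<Rightarrow> real) \<Rightarrow> bool" where
  "tame n \<xi> \<longleftrightarrow> (\<forall>v\<in>{1..n}. filterlim (ring_time \<xi> v) at_top sequentially)"

lemma finite_rings:
  assumes "tame n \<xi>"
  shows "finite (rings n \<xi> \<inter> {..t})"
proof -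
  have "finite (ring_time \<xi> v ` {k. ring_time \<xi> v k \<le> t})" if "v \<in> {1..n}" for v
  proof -
    have "eventually (\<lambda>k. t < ring_time \<xi> v k) sequentially"
      using assms that by (auto simp: tame_def filterlim_at_top_dense)
    then have "finite {k. \<not> t < ring_time \<xi> v k}"
      by (simp add: eventually_cofinite flip: cofinite_eq_sequentially)
    then show ?thesis by (simp add: not_less)
  qed
  then have "finite (\<Union>v\<in>{1..n}. ring_time \<xi> v ` {k. ring_time \<xi> v k \<le> t})" by blast
  moreover have "rings n \<xi> \<inter> {..t} \<subseteq> (\<Union>v\<in>{1..n}. ring_time \<xi> v ` {k. ring_time \<xi> v k \<le> t})"
    by (auto simp: rings_def)
  ultimately show ?thesis by (rule rev_finite_subset)
qed

lemma colouring_at_later: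
  assumes "tame n \<xi>" "t \<le> t'"
  shows "colouring_at n r (G, s, \<xi>) t' =
    fold (ring_step n r G \<xi>) (sorted_list_of_set (rings n \<xi> \<inter> {t<..t'})) (colouring_at n r (G, s, \<xi>) t)"
proof -
  let ?X = "rings n \<xi> \<inter> {..t}" and ?Y = "rings n \<xi> \<inter> {t<..t'}"
  have fin: "finite ?X" "finite ?Y"
    using finite_rings[OF assms(1), of t] finite_rings[OF assms(1), of t']
    by (auto elim: rev_finite_subset)
  have eq: "rings n \<xi> \<inter> {..t'} = ?X \<union> ?Y" using assms(2) by auto
  have "card (?X \<union> ?Y) = card ?X + card ?Y"
    using fin by (intro card_Un_disjoint) auto
  then have "sorted_list_of_set (?X \<union> ?Y) = sorted_list_of_set ?X @ sorted_list_of_set ?Y"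
    using fin by (intro sorted_list_of_set_unique[THEN iffD1]) (auto simp: sorted_wrt_append)
  then show ?thesis unfolding colouring_at_rings eq by simp
qed

lemma fold_ring_step_coloured: "c v \<noteq> White \<Longrightarrow> fold (ring_step n r G \<xi>) ts c v = c v"
  by (induction ts arbitrary: c) (auto simp: ring_step_def)

text \<open>Either some node changes before the clock of \<open>v\<close> rings at \<open>t\<close>,
  or the colouring is still \<open>c\<close> at that moment and \<open>v\<close> itself
  changes.\<close>

lemma fold_ring_step_progress:
  assumes "t \<in> set ts" "ring_time \<xi> v k = t"
    and "v \<in> {1..n}" "c v = White" "threshold n r G c Red v \<or> threshold n r G c Black v"
  shows "\<exists>u\<in>{1..n}. c u = White \<and> fold (ring_step n r G \<xi>) ts c u \<noteq> White"
  using assms(1)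
proof (induction ts)
  case (Cons x ts)
  show ?case
  proof (cases "ring_step n r G \<xi> x c = c")
    case True
    have "x \<noteq> t"
    proof
      assume "x = t"
      then have "ring_step n r G \<xi> x c v \<noteq> White" using assms by (auto simp: ring_step_def)
      with True assms(4) show False by simp
    qed
    with Cons True show ?thesis by simp
  next
    case False
    then obtain u where "ring_step n r G \<xi> x c u \<noteq> c u" by blast
    then have "u \<in> {1..n}" "c u = White" "ring_step n r G \<xi> x c u \<noteq> White"
      by (auto simp: ring_step_def split: if_splits)
    then show ?thesis by (auto simp: fold_ring_step_coloured)
  qed
qed auto

text \<open>The number of coloured nodes is at most \<open>n\<close>, so it is maximal at some time.
  A white node meeting a threshold then would ring later, and by that ring an additional node would
  have been coloured.\<close>

lemma ex_terminal:
  assumes "tame n \<xi>"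
  shows "\<exists>t\<ge>0. terminal n r G (colouring_at n r (G, s, \<xi>) t)"
proof -
  define C where "C t = {v \<in> {1..n}. colouring_at n r (G, s, \<xi>) t v \<noteq> White}" for t
  have "C t \<subseteq> {1..n}" for t by (auto simp: C_def)
  then have "card (C t) \<le> n" for t
    using card_mono[of "{1..n}" "C t"] by simp
  then obtain t where t: "0 \<le> t" "\<And>t'. 0 \<le> t' \<Longrightarrow> card (C t') \<le> card (C t)"
    using ex_has_greatest_nat[of "\<lambda>t. 0 \<le> t" 0 "\<lambda>t. card (C t)" "Suc n"] by (auto simp: less_Suc_eq_le)
  let ?c = "colouring_at n r (G, s, \<xi>) t"
  have "terminal n r G ?c"
  proof (rule ccontr)
    assume "\<not> terminal n r G ?c"
    then obtain v where v: "v \<in> {1..n}" "?c v = White" "threshold n r G ?c Red v \<or> threshold n r G ?c Black v"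
      unfolding terminal_def by blast
    have "eventually (\<lambda>k. t < ring_time \<xi> v k) sequentially"
      using assms v(1) by (auto simp: tame_def filterlim_at_top_dense)
    then obtain k where k: "t < ring_time \<xi> v k"
      by (auto simp: eventually_sequentially)
    define t' where "t' = ring_time \<xi> v k"
    have "finite (rings n \<xi> \<inter> {t<..t'})"
      using finite_rings[OF assms, of t'] by (auto elim: rev_finite_subset)
    then have "t' \<in> set (sorted_list_of_set (rings n \<xi> \<inter> {t<..t'}))"
      using k v(1) by (auto simp: t'_def rings_def)
    note later = colouring_at_later[OF assms less_imp_le[OF k], folded t'_def, of r G s]
    obtain u where u: "u \<in> C t' - C t"
      using fold_ring_step_progress[OF \<open>t' \<in> _\<close> t'_def[symmetric] v, folded later]
      unfolding C_def by blast
    have "C t \<subseteq> C t'"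
      unfolding C_def later by (auto simp: fold_ring_step_coloured)
    with u have "card (C t) < card (C t')"
      by (intro psubset_card_mono) (auto simp: C_def)
    with t(2)[of t'] t(1) k show False by (simp add: t'_def)
  qed
  with t(1) show ?thesis by blast
qed

text \<open>Just after the infimum there is an interval without rings; a terminal time inside it
  shows the same colouring as the infimum itself.\<close>

lemma terminal_stop_time:
  assumes "tame n \<xi>"
  shows "terminal n r G (colouring_at n r (G, s, \<xi>) (stop_time n r (G, s, \<xi>)))"
proof -
  let ?T = "{t. 0 \<le> t \<and> terminal n r G (colouring_at n r (G, s, \<xi>) t)}"
  define \<tau> where "\<tau> = Inf ?T"
  have ne: "?T \<noteq> {}" using ex_terminal[OF assms, of r G s] by blast
  have bdd: "bdd_below ?T" by (rule bdd_belowI[of _ 0]) blast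
  define F where "F = rings n \<xi> \<inter> {\<tau><..\<tau> + 1}"
  have fin: "finite F"
    using finite_rings[OF assms, of "\<tau> + 1"] by (auto simp: F_def elim: rev_finite_subset)
  \<comment> \<open>The extra element \<open>\<tau> + 1\<close> makes the minimum exist when the
    window contains no ring, and keeps \<open>m\<close> within the window.\<close>
  define m where "m = Min (insert (\<tau> + 1) F)"
  have "\<tau> < m" using fin by (auto simp: m_def F_def)
  then obtain t where t: "t \<in> ?T" "t < m"
    using cInf_lessD[OF ne] unfolding \<tau>_def by blast
  have "\<tau> \<le> t" unfolding \<tau>_def by (rule cInf_lower[OF t(1) bdd])
  have m: "m \<le> x" if "x \<in> insert (\<tau> + 1) F" for x using fin that by (simp add: m_def)
  have "x \<notin> {\<tau><..t}" if "x \<in> rings n \<xi>" for x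
  proof
    assume x: "x \<in> {\<tau><..t}"
    then have "x \<in> F" using that t(2) m[of "\<tau> + 1"] by (simp add: F_def)
    then have "m \<le> x" by (intro m) simp
    with x t(2) show False by simp
  qed
  then have "rings n \<xi> \<inter> {\<tau><..t} = {}" by blast
  then have "colouring_at n r (G, s, \<xi>) t = colouring_at n r (G, s, \<xi>) \<tau>"
    using colouring_at_later[OF assms \<open>\<tau> \<le> t\<close>, of r G s] by simp
  then show ?thesis
    using t(1) by (simp add: stop_time_def \<tau>_def)
qed

lemma A_star_le:
  assumes "fst s \<inter> snd s = {}" "S \<in> {Red, Black}"
  shows "A_star n r (G, s, \<xi>) S \<le> card (reach n r G (seeds_of s S) (seeds_of s (opposite S)))"
proof -
  have "{v \<in> {1..n}. colouring_at n r (G, s, \<xi>) (stop_time n r (G, s, \<xi>)) v = S}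
      \<subseteq> reach n r G (seeds_of s S) (seeds_of s (opposite S))"
    using consistent_colouring_at[OF assms(1), of n r G \<xi> "stop_time n r (G, s, \<xi>)"] assms(2)
    unfolding consistent_def by blast
  then show ?thesis
    unfolding A_star_def by (intro card_mono) (auto simp: reach_def finite_bclose)
qed

lemma A_star_ge:
  assumes "fst s \<inter> snd s = {}" "S \<in> {Red, Black}" "0 < r" "tame n \<xi>"
  shows "card (safe n r G (seeds_of s S) (seeds_of s (opposite S))) \<le> A_star n r (G, s, \<xi>) S"
  unfolding A_star_def
  by (intro card_mono safe_subset_coloured consistent_colouring_at terminal_stop_time assms) auto

section \<open>The clocks\<close>

text \<open>Multiplying the rate 1 density by \<open>exp (- x)\<close> gives half the density of
  rate 2, whose mass is 1.\<close>

lemma nn_integral_exp_minus_exponential: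
  "(\<integral>\<^sup>+x. ennreal (exp (- x)) \<partial>density lborel (\<lambda>x. ennreal (exponential_density 1 x))) = ennreal (1 / 2)"
proof -
  have *: "ennreal (exponential_density 1 x) * ennreal (exp (- x))
      = ennreal (1 / 2 * exponential_density 2 x)" for x :: real
    by (auto simp: exponential_density_def algebra_simps simp flip: ennreal_mult' exp_add)
  have "(\<integral>\<^sup>+x. ennreal (exponential_density 2 x) \<partial>lborel) = 1"
    using prob_space.emeasure_space_1[OF prob_space_exponential_density[of 2]]
    by (simp add: emeasure_density)
  then show ?thesis
    by (simp add: nn_integral_density * ennreal_mult' nn_integral_cmult del: times_divide_eq_left)
qed

text \<open>Markov's inequality for \<open>exp\<close> of minus the sum shows that
  \<open>k + 1\<close> waiting times add up to at most \<open>m\<close> with probability at most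
  \<open>exp m * (1 / 2) ^ Suc k\<close>. This is summable in \<open>k\<close>, so each level
  \<open>m\<close> is passed for good.\<close>

lemma AE_waiting_times_sum_at_top:
  defines "D \<equiv> density lborel (\<lambda>x. ennreal (exponential_density 1 x))"
  shows "AE x in PiM UNIV (\<lambda>_::nat. D). filterlim (\<lambda>k. \<Sum>j\<le>k. x j) at_top sequentially"
proof -
  interpret D: prob_space D
    unfolding D_def by (rule prob_space_exponential_density) simp
  let ?P = "PiM UNIV (\<lambda>_::nat. D)"
  interpret P: prob_space ?P
    by (intro prob_space_PiM) unfold_locales
  have setsD: "sets D = sets borel" by (simp add: D_def)
  have meas: "(\<lambda>x. x j) \<in> borel_measurable ?P" for j
  proof -
    have "(\<lambda>x. x j) \<in> ?P \<rightarrow>\<^sub>M D" by measurable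
    then show ?thesis by (simp add: measurable_cong_sets[OF refl setsD])
  qed
  define A where "A m k = {x \<in> space ?P. (\<Sum>j\<le>k. x j) \<le> real m}" for m k
  have A: "A m k \<in> sets ?P" for m k
    unfolding A_def using meas by measurable
  have prod: "(\<integral>\<^sup>+x. (\<Prod>j\<le>k. ennreal (exp (- x j))) \<partial>?P) = ennreal ((1 / 2) ^ Suc k)" for k
  proof -
    \<comment> \<open>The product formula concerns finitely many coordinates, so the integral is
      moved to the marginal on \<open>{..k}\<close>.\<close>
    interpret PP: product_prob_space "\<lambda>_::nat. D" UNIV by unfold_locales
    have m [measurable]: "(\<lambda>x. ennreal (exp (- x))) \<in> borel_measurable D"
      by (simp add: measurable_cong_sets[OF setsD refl])
    have "(\<integral>\<^sup>+x. (\<Prod>j\<le>k. ennreal (exp (- x j))) \<partial>PiM {..k} (\<lambda>_. D))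
        = (\<integral>\<^sup>+x. (\<Prod>j\<le>k. ennreal (exp (- restrict x {..k} j))) \<partial>?P)"
    proof (subst PP.distr_PiM_restrict_finite[symmetric, of "{..k}"])
      show "(\<integral>\<^sup>+x. (\<Prod>j\<le>k. ennreal (exp (- x j))) \<partial>distr ?P (PiM {..k} (\<lambda>_. D)) (\<lambda>x. restrict x {..k}))
          = (\<integral>\<^sup>+x. (\<Prod>j\<le>k. ennreal (exp (- restrict x {..k} j))) \<partial>?P)"
        by (rule nn_integral_distr) (simp_all add: measurable_restrict_subset)
    qed simp_all
    also have "\<dots> = (\<integral>\<^sup>+x. (\<Prod>j\<le>k. ennreal (exp (- x j))) \<partial>?P)"
      by (intro nn_integral_cong prod.cong) auto
    finally have "(\<integral>\<^sup>+x. (\<Prod>j\<le>k. ennreal (exp (- x j))) \<partial>?P) = (\<Prod>j\<le>k. \<integral>\<^sup>+x. ennreal (exp (- x)) \<partial>D)"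
      by (subst (asm) PP.product_nn_integral_prod) (simp, rule m, rule sym)
    also have "\<dots> = (\<Prod>j\<le>k. ennreal (1 / 2))"
      using nn_integral_exp_minus_exponential by (simp only: D_def)
    also have "\<dots> = ennreal (\<Prod>j\<le>k. 1 / 2)"
      by (rule prod_ennreal) simp
    finally show ?thesis by simp
  qed
  have bound: "measure ?P (A m k) \<le> exp (real m) * (1 / 2) ^ Suc k" for m k
  proof -
    have "emeasure ?P (A m k) = (\<integral>\<^sup>+x. indicator (A m k) x \<partial>?P)"
      using A by simp
    also have "\<dots> \<le> (\<integral>\<^sup>+x. ennreal (exp (real m)) * (\<Prod>j\<le>k. ennreal (exp (- x j))) \<partial>?P)"
    proof (intro nn_integral_mono)
      fix x
      have "1 \<le> exp (real m) * (\<Prod>j\<le>k. exp (- x j))" if "x \<in> A m k"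
        using that by (simp add: A_def sum_negf flip: exp_sum exp_add)
      then show "indicator (A m k) x \<le> ennreal (exp (real m)) * (\<Prod>j\<le>k. ennreal (exp (- x j)))"
        by (auto simp: indicator_def prod_ennreal simp flip: ennreal_mult' ennreal_1 intro!: ennreal_leI)
    qed
    also have "\<dots> = ennreal (exp (real m)) * ennreal ((1 / 2) ^ Suc k)"
    proof (subst nn_integral_cmult)
      show "(\<lambda>x. \<Prod>j\<le>k. ennreal (exp (- x j))) \<in> borel_measurable ?P"
        by (intro borel_measurable_prod_ennreal
            measurable_compose[OF meas, where g = "\<lambda>x. ennreal (exp (- x))"]) simp
    qed (simp only: prod)
    also have "\<dots> = ennreal (exp (real m) * (1 / 2) ^ Suc k)"
      by (rule ennreal_mult'[symmetric]) simp
    finally show ?thesis by (simp add: P.emeasure_eq_measure)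
  qed
  have "summable (\<lambda>k. measure ?P (A m k))" for m
  proof (rule summable_comparison_test')
    show "summable (\<lambda>k. (exp (real m) / 2) * (1 / 2) ^ k)"
      by (intro summable_mult summable_geometric) simp
    show "norm (measure ?P (A m k)) \<le> (exp (real m) / 2) * (1 / 2) ^ k" if "k \<ge> 0" for k
      using bound[of m k] by simp
  qed
  then have "AE x in ?P. eventually (\<lambda>k. x \<in> space ?P - A m k) sequentially" for m
    by (intro borel_cantelli_AE1 A) (simp_all add: P.emeasure_eq_measure)
  then have "AE x in ?P. \<forall>m. eventually (\<lambda>k. x \<in> space ?P - A m k) sequentially"
    by (simp add: AE_all_countable)
  then show ?thesis
  proof eventually_elim
    case (elim x)
    show ?case
      unfolding filterlim_at_top
    proof
      fix Z :: real
      obtain m where "Z \<le> real m" using real_arch_simple by blast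
      with elim[rule_format, of m] show "eventually (\<lambda>k. Z \<le> (\<Sum>j\<le>k. x j)) sequentially"
        by (auto simp: A_def elim!: eventually_mono)
    qed
  qed
qed

lemma AE_tame: "AE \<xi> in clocks_measure n. tame n \<xi>"
proof -
  let ?D = "density lborel (\<lambda>x. ennreal (exponential_density 1 x))"
  have "prob_space ?D"
    by (rule prob_space_exponential_density) simp
  then have "prob_space (PiM UNIV (\<lambda>_::nat. ?D))"
    by (intro prob_space_PiM)
  then have "AE \<xi> in clocks_measure n. filterlim (\<lambda>k. \<Sum>j\<le>k. \<xi> v j) at_top sequentially"
    if "v \<in> {1..n}" for v
    unfolding clocks_measure_def using that AE_waiting_times_sum_at_top
    by (intro AE_PiM_component[where P = "\<lambda>x. filterlim (\<lambda>k. \<Sum>j\<le>k. x j) at_top sequentially"])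
  then have "AE \<xi> in clocks_measure n. \<forall>v\<in>{1..n}. filterlim (\<lambda>k. \<Sum>j\<le>k. \<xi> v j) at_top sequentially"
    by (intro AE_ball_countable[THEN iffD2]) auto
  then show ?thesis
    by (simp add: tame_def ring_time_def[abs_def])
qed

section \<open>The function \<open>beta_fun\<close>\<close>

abbreviation growth_const :: "nat \<Rightarrow> real" where
  "growth_const r \<equiv> 1 / real r * (1 - 1 / real r) ^ (r - 1)"

text \<open>The minimum of \<open>beta_fun r \<alpha>\<close> on the positive half line is at \<open>x + \<alpha> = r / (r - 1)\<close>, with value
  \<open>\<alpha> - 1\<close>.\<close>

lemma beta_fun_minimum:
  assumes "2 \<le> r"
  shows "beta_fun r \<alpha> (real r / (real r - 1) - \<alpha>) = \<alpha> - 1"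
proof -
  have r: "real r - 1 > 0" using assms by simp
  have eq: "1 - 1 / real r = 1 / (real r / (real r - 1))"
    using r by (simp add: field_simps)
  have "(1 - 1 / real r) ^ (r - 1) * (real r / (real r - 1)) ^ r
      = (1 - 1 / real r) ^ (r - 1) * (real r / (real r - 1)) ^ (r - 1) * (real r / (real r - 1))"
    using assms power_minus_mult[of r "real r / (real r - 1)"] by (simp only: mult.assoc)
  also have "(1 - 1 / real r) ^ (r - 1) * (real r / (real r - 1)) ^ (r - 1) = 1"
    using r by (simp add: eq flip: power_mult_distrib)
  finally have "beta_fun r \<alpha> (real r / (real r - 1) - \<alpha>) = 1 / real r * (real r / (real r - 1)) - (real r / (real r - 1) - \<alpha>)"
    using assms by (simp add: beta_fun_def of_nat_diff)
  also have "\<dots> = \<alpha> - 1" using r by (simp add: field_simps)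
  finally show ?thesis .
qed

text \<open>The derivative at \<open>t\<close> is
  \<open>((1 - 1 / r) * (t + \<alpha>)) ^ (r - 1) - 1\<close>, negative to the left of the
  minimum.\<close>

lemma beta_fun_strict_decreasing:
  assumes r: "2 \<le> r" and xy: "- \<alpha> \<le> x" "x < y" "y \<le> real r / (real r - 1) - \<alpha>"
  shows "beta_fun r \<alpha> y < beta_fun r \<alpha> x"
proof (rule DERIV_neg_imp_decreasing_open[OF xy(2)])
  fix t assume t: "x < t" "t < y"
  have "0 < t + \<alpha>" using xy t by linarith
  have lt: "(1 - 1 / real r) * (t + \<alpha>) < 1"
  proof -
    have "t + \<alpha> < real r / (real r - 1)" using xy t by linarith
    then show ?thesis using r by (simp add: field_simps)
  qed
  have "((1 - 1 / real r) * (t + \<alpha>)) ^ (r - 1) < 1"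
    using power_strict_mono[OF lt, of "r - 1"] \<open>0 < t + \<alpha>\<close> r by simp
  moreover have "(beta_fun r \<alpha> has_real_derivative
      growth_const r * (real r * (t + \<alpha>) ^ (r - 1)) - 1) (at t)"
    unfolding beta_fun_def[abs_def] by (auto intro!: derivative_eq_intros)
  moreover have "growth_const r * (real r * (t + \<alpha>) ^ (r - 1)) = ((1 - 1 / real r) * (t + \<alpha>)) ^ (r - 1)"
    using r by (simp add: power_mult_distrib)
  ultimately show "\<exists>D. (beta_fun r \<alpha> has_real_derivative D) (at t) \<and> D < 0"
    by (intro exI conjI) auto
qed (use r in \<open>auto simp: beta_fun_def[abs_def] intro!: continuous_intros\<close>)

text \<open>The ranges start at \<open>- \<alpha>\<close> because the lemma is applied to
  \<open>w - \<alpha>\<close>, where \<open>w \<ge> 0\<close> is a closure size divided by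
  \<open>q\<close>. The witness \<open>x1\<close> is the minimum point. Monotonicity turns
  positivity at one point into a uniform lower bound before it.\<close>

lemma least_zero_properties:
  assumes r: "2 \<le> r" and \<alpha>: "0 < \<alpha>" "\<alpha> < 1"
  shows "0 < least_zero r \<alpha> \<and> (\<exists>x1 > least_zero r \<alpha>.
    (\<forall>x. - \<alpha> \<le> x \<longrightarrow> x < least_zero r \<alpha> \<longrightarrow> 0 < beta_fun r \<alpha> x) \<and>
    (\<forall>x. least_zero r \<alpha> < x \<longrightarrow> x \<le> x1 \<longrightarrow> beta_fun r \<alpha> x < 0) \<and>
    (\<forall>x y. - \<alpha> \<le> x \<longrightarrow> x \<le> y \<longrightarrow> y \<le> x1 \<longrightarrow> beta_fun r \<alpha> y \<le> beta_fun r \<alpha> x))"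
proof -
  define x1 where "x1 = real r / (real r - 1) - \<alpha>"
  have "1 \<le> real r / (real r - 1)" using r by (simp add: field_simps)
  then have x1: "0 < x1" using \<alpha> by (simp add: x1_def)
  have dec: "beta_fun r \<alpha> y < beta_fun r \<alpha> x" if "- \<alpha> \<le> x" "x < y" "y \<le> x1" for x y
    using beta_fun_strict_decreasing[OF r that(1,2)] that(3) by (simp add: x1_def)
  have "beta_fun r \<alpha> x1 < 0" using beta_fun_minimum[OF r, of \<alpha>] \<alpha> by (simp add: x1_def)
  moreover have "0 < beta_fun r \<alpha> 0" using r \<alpha> by (simp add: beta_fun_def)
  moreover have "continuous_on {0..x1} (beta_fun r \<alpha>)"
    using r by (auto simp: beta_fun_def[abs_def] intro!: continuous_intros)
  ultimately obtain z where z: "0 \<le> z" "z \<le> x1" "beta_fun r \<alpha> z = 0"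
    using IVT2'[of "beta_fun r \<alpha>" x1 0 0] x1 by auto
  have "z \<noteq> 0" "z \<noteq> x1" using z \<open>0 < beta_fun r \<alpha> 0\<close> \<open>beta_fun r \<alpha> x1 < 0\<close> by auto
  then have z': "0 < z" "z < x1" using z by auto
  have "least_zero r \<alpha> = z"
    unfolding least_zero_def
  proof (rule Least_equality)
    fix y assume "0 < y \<and> beta_fun r \<alpha> y = 0"
    then show "z \<le> y" using dec[of y z] z \<alpha> by (cases "y < z") auto
  qed (use z z' in auto)
  moreover have "0 < beta_fun r \<alpha> x" if "- \<alpha> \<le> x" "x < z" for x
    using dec[of x z] that z z' by simp
  moreover have "beta_fun r \<alpha> x < 0" if "z < x" "x \<le> x1" for x
    using dec[of z x] that z z' \<alpha> by simp
  moreover have "beta_fun r \<alpha> y \<le> beta_fun r \<alpha> x" if "- \<alpha> \<le> x" "x \<le> y" "y \<le> x1" for x y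
    using dec[of x y] that by (cases "x = y") simp_all
  ultimately show ?thesis using z' by auto
qed

section \<open>The subcritical scaling\<close>

text \<open>\<open>fact t * (j choose t)\<close> is a product of \<open>t\<close> factors, each at
  least \<open>j - t\<close>.\<close>

lemma falling_power_le_binomial:
  assumes "t \<le> j"
  shows "(real j - real t) ^ t \<le> fact t * real (j choose t)"
  using assms
proof (induction t)
  case (Suc t)
  have eq: "fact (Suc t) * real (j choose Suc t) = (real j - real t) * (fact t * real (j choose t))"
  proof -
    have "Suc t * (j choose Suc t) = (j - t) * (j choose t)"
      using binomial_absorb_comp[of j t] binomial_absorption[of t "j"] Suc.prems
      by (metis Suc_times_binomial_eq mult.commute)
    then have "real (Suc t) * real (j choose Suc t) = (real j - real t) * real (j choose t)"
      using Suc.prems by (metis Suc_leD of_nat_diff of_nat_mult)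
    moreover have "fact (Suc t) * real (j choose Suc t) = fact t * (real (Suc t) * real (j choose Suc t))"
      by (simp only: fact_Suc of_nat_mult mult_ac)
    ultimately show ?thesis by (simp only: mult_ac)
  qed
  have "(real j - real (Suc t)) ^ Suc t \<le> (real j - real t) ^ Suc t"
    using Suc.prems by (intro power_mono) auto
  also have "\<dots> \<le> (real j - real t) * (fact t * real (j choose t))"
    using Suc by (simp add: mult_left_mono)
  finally show ?case by (simp only: eq)
qed auto

locale subcritical_scaling =
  fixes r :: nat and p :: "nat \<Rightarrow> real"
  assumes r: "2 \<le> r"
    and p: "\<And>n. n \<ge> 1 \<Longrightarrow> 0 < p n \<and> p n < 1"
    and p_lower: "(\<lambda>n. 1 / real n) \<in> o(p)"
    and p_upper: "p \<in> o(\<lambda>n. 1 / (real n powr (1 / real r) * ln (real n)))"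
begin

abbreviation q :: "nat \<Rightarrow> real" where "q \<equiv> crit_size r p"

definition D :: real where "D = (1 - 1 / real r) ^ (r - 1) * fact (r - 1)"

lemma D_pos: "0 < D"
  using r by (simp add: D_def)

lemma q_pos: "n \<ge> 1 \<Longrightarrow> 0 < q n"
  using r p[of n] by (simp add: crit_size_def)

lemma q_power: "n \<ge> 1 \<Longrightarrow> real n * p n ^ r * q n ^ (r - 1) = D"
proof -
  assume n: "n \<ge> 1"
  define x where "x = fact (r - 1) / (real n * p n ^ r)"
  have x: "0 < x" using p[OF n] n by (simp add: x_def)
  have "(x powr (1 / (real r - 1))) ^ (r - 1) = (x powr (1 / (real r - 1))) powr real (r - 1)"
    using x by (intro powr_realpow[symmetric]) simp
  also have "\<dots> = x powr (1 / (real r - 1) * real (r - 1))" by (rule powr_powr)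
  also have "\<dots> = x" using r x by (simp add: of_nat_diff)
  finally have "q n ^ (r - 1) = (1 - 1 / real r) ^ (r - 1) * x"
    by (simp add: crit_size_def x_def power_mult_distrib)
  then show ?thesis using p[OF n] n by (simp add: D_def x_def)
qed

text \<open>To leading order, the expected number of nodes with \<open>r\<close> neighbours among
  \<open>x\<close> active ones, in units of \<open>q\<close>. The coefficient in
  \<open>beta_fun\<close> arises here.\<close>

lemma growth_eq:
  assumes n: "n \<ge> 1"
  shows "real n * (x * p n) ^ r / fact r = q n * (growth_const r * (x / q n) ^ r)"
proof -
  have q: "0 < q n" by (rule q_pos[OF n])
  have f: "fact r = real r * fact (r - 1)" using r by (simp add: fact_reduce)
  have "q n * (growth_const r * (x / q n) ^ r) = growth_const r * x ^ r * (q n / q n ^ r)"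
    by (simp add: power_divide)
  also have "q n / q n ^ r = 1 / q n ^ (r - 1)"
    using q r power_minus_mult[of r "q n"] by (simp add: field_simps)
  also have "\<dots> = real n * p n ^ r / D"
    using q_power[OF n] D_pos q by (simp add: field_simps)
  also have "growth_const r * x ^ r * (real n * p n ^ r / D) = real n * (x * p n) ^ r / fact r"
    using r unfolding D_def f by (simp add: power_mult_distrib)
  finally show ?thesis by simp
qed

lemma inverse_np_tendsto: "(\<lambda>n. 1 / real n / p n) \<longlonglongrightarrow> 0"
  using p_lower by (rule smalloD_tendsto)

text \<open>By \<open>q_power\<close>, \<open>(p q) ^ (r - 1)\<close> equals
  \<open>D / (n p)\<close>, which vanishes because \<open>1 / n\<close> is
  \<open>o(p)\<close>.\<close>

lemma pq_tendsto: "(\<lambda>n. p n * q n) \<longlonglongrightarrow> 0"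
proof -
  have "eventually (\<lambda>n. D * (1 / real n / p n) = (p n * q n) ^ (r - 1)) sequentially"
    using eventually_ge_at_top[of 1]
  proof eventually_elim
    case (elim n)
    have "(p n * q n) ^ (r - 1) * (real n * p n) = D"
    proof -
      have "(p n * q n) ^ (r - 1) * (real n * p n) = real n * (p n ^ (r - 1) * p n) * q n ^ (r - 1)"
        by (simp only: power_mult_distrib mult_ac)
      also have "p n ^ (r - 1) * p n = p n ^ r" using r by (intro power_minus_mult) simp
      finally show ?thesis by (simp only: q_power[OF elim])
    qed
    then show ?case using elim p[OF elim] by (simp add: field_simps)
  qed
  moreover have "(\<lambda>n. D * (1 / real n / p n)) \<longlonglongrightarrow> D * 0"
    by (intro tendsto_intros inverse_np_tendsto)
  ultimately have "(\<lambda>n. (p n * q n) ^ (r - 1)) \<longlonglongrightarrow> 0"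
    by (simp add: filterlim_cong[OF refl refl])
  then have "(\<lambda>n. root (r - 1) ((p n * q n) ^ (r - 1))) \<longlonglongrightarrow> root (r - 1) 0"
    by (rule tendsto_real_root)
  moreover have "eventually (\<lambda>n. root (r - 1) ((p n * q n) ^ (r - 1)) = p n * q n) sequentially"
    using eventually_ge_at_top[of 1]
  proof eventually_elim
    case (elim n)
    then show ?case using r p[OF elim] q_pos[OF elim] by (intro real_root_power_cancel) auto
  qed
  ultimately show ?thesis by (simp add: filterlim_cong[OF refl refl])
qed

lemma q_div_n_tendsto: "(\<lambda>n. q n / real n) \<longlonglongrightarrow> 0"
proof -
  have "(\<lambda>n. p n * q n * (1 / real n / p n)) \<longlonglongrightarrow> 0 * 0"
    by (intro tendsto_intros pq_tendsto inverse_np_tendsto)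
  moreover have "eventually (\<lambda>n. p n * q n * (1 / real n / p n) = q n / real n) sequentially"
    using eventually_ge_at_top[of 1]
  proof eventually_elim
    case (elim n)
    then show ?case using p[OF elim] by (simp add: field_simps)
  qed
  ultimately show ?thesis by (simp add: filterlim_cong[OF refl refl])
qed

text \<open>By \<open>q_power\<close>, \<open>q ^ (r - 1)\<close> is \<open>D / (n p ^ r)\<close>,
  and the upper bound on \<open>p\<close> makes this at least a large multiple of the
  \<open>r\<close>-th power of \<open>ln n\<close>, one logarithm more than the required power
  \<open>r - 1\<close>.\<close>

lemma q_ge_ln: 
  assumes "0 < K"
  shows "eventually (\<lambda>n. K * ln (real n) \<le> q n) sequentially"
proof -
  \<comment> \<open>\<open>c \<le> 1\<close> gives \<open>c ^ r \<le> c\<close>, and the other bound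
    then gives \<open>K ^ (r - 1) * c ^ r \<le> D\<close>.\<close>
  define c where "c = min 1 (D / K ^ (r - 1))"
  have c: "0 < c" "c \<le> 1" "c \<le> D / K ^ (r - 1)"
    using D_pos assms by (auto simp: c_def)
  have "c ^ r \<le> c ^ 1" using c r by (intro power_decreasing) auto
  then have c': "K ^ (r - 1) * c ^ r \<le> D"
  proof -
    have "K ^ (r - 1) * c ^ r \<le> K ^ (r - 1) * c"
      using \<open>c ^ r \<le> c ^ 1\<close> assms by (intro mult_left_mono) auto
    also have "\<dots> \<le> D" using c(3) assms by (simp add: field_simps)
    finally show ?thesis .
  qed
  have "eventually (\<lambda>n. norm (p n) \<le> c * norm (1 / (real n powr (1 / real r) * ln (real n)))) sequentially"
    using landau_o.smallD[OF p_upper c(1)] .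
  moreover have "eventually (\<lambda>n::nat. 1 \<le> ln (real n)) sequentially"
    by real_asymp
  ultimately show ?thesis
    using eventually_ge_at_top[of 1]
  proof eventually_elim
    case (elim n)
    define L where "L = ln (real n)"
    have L: "1 \<le> L" using elim by (simp add: L_def)
    have pn: "0 < p n" using p[OF elim(3)] by simp
    have "p n \<le> c / (real n powr (1 / real r) * L)"
      using elim(1) pn L by (simp add: L_def)
    then have "p n ^ r \<le> (c / (real n powr (1 / real r) * L)) ^ r"
      using pn by (intro power_mono) auto
    also have "\<dots> = c ^ r / (real n * L ^ r)"
    proof -
      have "(real n powr (1 / real r)) ^ r = (real n powr (1 / real r)) powr real r"
        using elim(3) by (intro powr_realpow[symmetric]) simp
      also have "\<dots> = real n" using r elim(3) by (simp add: powr_powr)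
      finally show ?thesis by (simp only: power_divide power_mult_distrib)
    qed
    finally have "real n * p n ^ r * L ^ r \<le> c ^ r"
      using elim(3) L by (simp add: field_simps)
    then have "K ^ (r - 1) * (real n * p n ^ r * L ^ r) \<le> K ^ (r - 1) * c ^ r"
      using assms by (intro mult_left_mono) auto
    also have "\<dots> \<le> real n * p n ^ r * q n ^ (r - 1)"
      using c' q_power[OF elim(3)] by simp
    finally have "(real n * p n ^ r) * (K ^ (r - 1) * L ^ r) \<le> (real n * p n ^ r) * q n ^ (r - 1)"
      by (simp add: mult_ac)
    then have "K ^ (r - 1) * L ^ r \<le> q n ^ (r - 1)"
      using pn elim(3) by simp
    moreover have "L ^ (r - 1) \<le> L ^ r" using L by (intro power_increasing) auto
    then have "K ^ (r - 1) * L ^ (r - 1) \<le> K ^ (r - 1) * L ^ r"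
      using assms by (intro mult_left_mono) auto
    ultimately have "(K * L) ^ (r - 1) \<le> q n ^ (r - 1)"
      by (simp add: power_mult_distrib)
    then show ?case
      using power_mono_iff[of "K * L" "q n" "r - 1"] r q_pos[OF elim(3)] assms L by (simp add: L_def)
  qed
qed

lemma q_at_top: "filterlim q at_top sequentially"
proof (rule filterlim_at_top_mono)
  show "filterlim (\<lambda>n::nat. ln (real n)) at_top sequentially" by real_asymp
  show "eventually (\<lambda>n. ln (real n) \<le> q n) sequentially" using q_ge_ln[of 1] by simp
qed

lemma exp_minus_q_le:
  assumes "0 < \<kappa>"
  shows "eventually (\<lambda>n. exp (- \<kappa> * q n) \<le> 1 / real n ^ m) sequentially"
proof -
  have "0 < (real m + 1) / \<kappa>" using assms by simp
  from q_ge_ln[OF this] eventually_ge_at_top[of 1] show ?thesis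
  proof eventually_elim
    case (elim n)
    have "real m * ln (real n) \<le> (real m + 1) * ln (real n)"
      using elim(2) by (intro mult_right_mono) auto
    also have "\<dots> \<le> \<kappa> * q n" using elim(1) assms by (simp add: field_simps)
    finally have "exp (- \<kappa> * q n) \<le> exp (- (real m * ln (real n)))" by simp
    also have "\<dots> = 1 / real n ^ m"
      using elim(2) by (simp add: exp_minus exp_of_nat_mult inverse_eq_divide)
    finally show ?case .
  qed
qed

end

section \<open>Deviation bounds for closure sizes at the scale of \<open>q\<close>\<close>

abbreviation edges :: "nat \<Rightarrow> nat set set" where
  "edges n \<equiv> {e. e \<subseteq> {1..n} \<and> card e = 2}"

lemma finite_edges: "finite (edges n)"
  by (rule finite_subset[of _ "Pow {1..n}"]) auto

lemma pairs_subset_edges: "W \<subseteq> {1..n} \<Longrightarrow> {{x, y} |x y. x \<in> W \<and> y \<in> W \<and> x \<noteq> y} \<subseteq> edges n"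
  by (auto simp: card_2_iff)

context subcritical_scaling
begin

text \<open>The quantity is \<open>exp (q E)\<close>, where \<open>E\<close> tends to
  \<open>(l - 1) * g - (y - \<alpha>) * ln l\<close> with \<open>g = growth_const r * y ^ r\<close>.
  The derivative of this limit at \<open>l = 1\<close> is \<open>g - (y - \<alpha>) < 0\<close>, so
  some \<open>l\<close> slightly above 1 makes it negative.\<close>

lemma upper_exponent:
  assumes a: "(\<lambda>n. real (a n) / q n) \<longlonglongrightarrow> \<alpha>"
    and y: "0 < y" "growth_const r * y ^ r < y - \<alpha>"
  obtains l where "1 < l"
    "eventually (\<lambda>n. l ^ a n / l ^ nat \<lceil>y * q n\<rceil> *
       exp ((l - 1) * (real n * (real (nat \<lceil>y * q n\<rceil>) * p n) ^ r / fact r)) \<le> 1 / real n ^ 3) sequentially"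
proof -
  define g where "g = growth_const r * y ^ r"
  have g: "0 < g" "g < y - \<alpha>" using y r by (auto simp: g_def)
  then have "1 < (y - \<alpha>) / g" by (simp add: field_simps)
  \<comment> \<open>An explicit range for \<open>l\<close>: since
    \<open>ln l \<ge> 1 - 1 / l\<close>, negativity of the limit follows from
    \<open>g < (y - \<alpha>) / l\<close>.\<close>
  then obtain l where l: "1 < l" "l < (y - \<alpha>) / g" using dense by blast
  have "1 - 1 / l \<le> ln l"
    using ln_le_minus_one[of "1 / l"] l(1) by (simp add: ln_div)
  then have "(y - \<alpha>) * (1 - 1 / l) \<le> (y - \<alpha>) * ln l"
    using g by (intro mult_left_mono) auto
  moreover have "(l - 1) * g < (l - 1) * ((y - \<alpha>) / l)"
    using l g by (intro mult_strict_left_mono) (auto simp: field_simps)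
  moreover have "(l - 1) * ((y - \<alpha>) / l) = (y - \<alpha>) * (1 - 1 / l)"
    using l(1) by (simp add: field_simps)
  ultimately have neg: "(l - 1) * g - (y - \<alpha>) * ln l < 0" by linarith
  define j where "j n = nat \<lceil>y * q n\<rceil>" for n
  have jq: "(\<lambda>n. real (j n) / q n) \<longlonglongrightarrow> y"
  proof (rule tendsto_sandwich)
    have "eventually (\<lambda>n. y * q n \<le> real (j n) \<and> real (j n) \<le> y * q n + 1 \<and> 0 < q n) sequentially"
      using eventually_ge_at_top[of 1]
    proof eventually_elim
      case (elim n)
      have "0 < y * q n" using y(1) q_pos[OF elim] by simp
      then show ?case unfolding j_def using q_pos[OF elim] by linarith
    qed
    then show "eventually (\<lambda>n. y \<le> real (j n) / q n) sequentially"
      and "eventually (\<lambda>n. real (j n) / q n \<le> y + 1 / q n) sequentially"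
      by (auto simp: field_simps elim!: eventually_mono)
    have "(\<lambda>n. y + 1 / q n) \<longlonglongrightarrow> y + 0"
      by (intro tendsto_intros real_tendsto_divide_at_top[OF tendsto_const q_at_top])
    then show "(\<lambda>n. y + 1 / q n) \<longlonglongrightarrow> y" by simp
  qed simp
  define E where "E n = (l - 1) * (growth_const r * (real (j n) / q n) ^ r)
                          - (real (j n) / q n - real (a n) / q n) * ln l" for n
  have "E \<longlonglongrightarrow> (l - 1) * (growth_const r * y ^ r) - (y - \<alpha>) * ln l"
    unfolding E_def[abs_def] by (intro tendsto_intros jq a)
  then have "E \<longlonglongrightarrow> (l - 1) * g - (y - \<alpha>) * ln l" by (simp only: g_def)
  moreover define X where "X = (l - 1) * g - (y - \<alpha>) * ln l"
  moreover define \<kappa> where "\<kappa> = - X / 2"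
  have \<kappa>: "0 < \<kappa>" "X < - \<kappa>" using neg by (simp_all add: \<kappa>_def flip: X_def)
  ultimately have "eventually (\<lambda>n. E n < - \<kappa>) sequentially"
    by (auto intro: order_tendstoD(2))
  then have "eventually (\<lambda>n. l ^ a n / l ^ j n * exp ((l - 1) * (real n * (real (j n) * p n) ^ r / fact r))
      \<le> 1 / real n ^ 3) sequentially"
    using exp_minus_q_le[OF \<kappa>(1), of 3] eventually_ge_at_top[of 1]
  proof eventually_elim
    case (elim n)
    have q: "0 < q n" by (rule q_pos[OF elim(3)])
    have pow: "l ^ m = exp (real m * ln l)" for m
      using l(1) by (simp add: exp_of_nat_mult)
    have "l ^ a n / l ^ j n * exp ((l - 1) * (real n * (real (j n) * p n) ^ r / fact r))
        = exp (real (a n) * ln l - real (j n) * ln l + (l - 1) * (q n * (growth_const r * (real (j n) / q n) ^ r)))"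
      by (simp only: growth_eq[OF elim(3)] pow exp_diff exp_add)
    also have "real (a n) * ln l - real (j n) * ln l + (l - 1) * (q n * (growth_const r * (real (j n) / q n) ^ r))
        = E n * q n"
    proof -
      have "real (a n) = real (a n) / q n * q n" "real (j n) = real (j n) / q n * q n" using q by auto
      then have "real (a n) * ln l - real (j n) * ln l = - (real (j n) / q n - real (a n) / q n) * ln l * q n"
        by (metis (no_types) left_diff_distrib mult.commute mult.left_commute minus_diff_eq)
      then show ?thesis by (simp add: E_def algebra_simps)
    qed
    also have "exp (E n * q n) \<le> exp (- \<kappa> * q n)"
      using elim(1) q by (simp only: exp_le_cancel_iff) (intro mult_right_mono, auto)
    also have "\<dots> \<le> 1 / real n ^ 3" by (rule elim(2))
    finally show ?case .
  qed
  with l(1) show thesis by (intro that) (simp_all only: j_def)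
qed

text \<open>Each seed contributes a factor \<open>l\<close>, every other node at most
  \<open>exp ((l - 1) * (j p) ^ r / r!)\<close>. Uniformity in \<open>A\<close> and \<open>B\<close>
  allows averaging over the seeds afterwards.\<close>

lemma prob_reach_large:
  assumes a: "(\<lambda>n. real (a n) / q n) \<longlonglongrightarrow> \<alpha>"
    and y: "0 < y" "growth_const r * y ^ r < y - \<alpha>"
  shows "eventually (\<lambda>n. \<forall>A B. A \<subseteq> {1..n} \<longrightarrow> card A = a n \<longrightarrow> A \<inter> B = {} \<longrightarrow>
    measure_pmf.prob (random_edges (edges n) (p n))
      {f. y * q n \<le> real (card (bclose ({1..n} - B) (\<lambda>i. if i \<in> A then 0 else r) f))} \<le> 1 / real n ^ 3) sequentially"
proof -
  obtain l where l: "1 < l"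
    "eventually (\<lambda>n. l ^ a n / l ^ nat \<lceil>y * q n\<rceil> *
       exp ((l - 1) * (real n * (real (nat \<lceil>y * q n\<rceil>) * p n) ^ r / fact r)) \<le> 1 / real n ^ 3) sequentially"
    by (rule upper_exponent[OF a y])
  from l(2) eventually_ge_at_top[of 1] show ?thesis
  proof eventually_elim
    case (elim n)
    define j where "j = nat \<lceil>y * q n\<rceil>"
    have pn: "0 \<le> p n" "p n \<le> 1" using p[OF elim(2)] by auto
    show ?case
    proof (intro allI impI)
      fix A B assume A: "A \<subseteq> {1..n}" "card A = a n" "A \<inter> B = {}"
      let ?\<theta> = "\<lambda>i. if i \<in> A then 0 else r"
      let ?W = "{1..n} - B"
      let ?t = "(real j * p n) ^ r / fact r"
      have "(\<Prod>i\<in>?W - A. tail_weight (p n) l j (?\<theta> i)) \<le> (\<Prod>i\<in>?W - A. exp ((l - 1) * ?t))"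
      proof (intro prod_mono conjI)
        fix i assume i: "i \<in> ?W - A"
        show "0 \<le> tail_weight (p n) l j (?\<theta> i)" using pn l(1) by (intro tail_weight_nonneg) auto
        have "tail_weight (p n) l j (?\<theta> i) \<le> 1 + (l - 1) * ?t"
          using i l(1) mult_left_mono[OF binomial_tail_le[OF pn, of j r], of "l - 1"]
          by (simp add: tail_weight_def)
        also have "\<dots> \<le> exp ((l - 1) * ?t)" by (rule exp_ge_add_one_self)
        finally show "tail_weight (p n) l j (?\<theta> i) \<le> exp ((l - 1) * ?t)" .
      qed
      also have "\<dots> = exp ((l - 1) * ?t) ^ card (?W - A)" by simp
      also have "\<dots> \<le> exp ((l - 1) * ?t) ^ n"
      proof (rule power_increasing)
        show "card (?W - A) \<le> n" using card_mono[of "{1..n}" "?W - A"] by fastforce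
        show "1 \<le> exp ((l - 1) * ?t)" using l(1) pn by simp
      qed
      also have "\<dots> = exp ((l - 1) * (real n * (real j * p n) ^ r / fact r))"
        by (simp add: mult_ac flip: exp_of_nat_mult)
      finally have rest: "(\<Prod>i\<in>?W - A. tail_weight (p n) l j (?\<theta> i)) \<le> exp ((l - 1) * (real n * (real j * p n) ^ r / fact r))" .
      have "{f. y * q n \<le> real (card (bclose ?W ?\<theta> f))} = {f. j \<le> card (bclose ?W ?\<theta> f)}"
        by (auto simp: j_def nat_le_iff ceiling_le_iff)
      then have "measure_pmf.prob (random_edges (edges n) (p n)) {f. y * q n \<le> real (card (bclose ?W ?\<theta> f))}
          \<le> (\<Prod>i\<in>?W. tail_weight (p n) l j (?\<theta> i)) / l ^ j"
        using l(1) pn by (simp only:) (intro prob_card_bclose_ge finite_edges pairs_subset_edges, auto)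
      also have "(\<Prod>i\<in>?W. tail_weight (p n) l j (?\<theta> i))
          = (\<Prod>i\<in>?W - A. tail_weight (p n) l j (?\<theta> i)) * (\<Prod>i\<in>A. tail_weight (p n) l j (?\<theta> i))"
        using A by (intro prod.subset_diff) auto
      also have "(\<Prod>i\<in>A. tail_weight (p n) l j (?\<theta> i)) = l ^ a n" using A by simp
      also have "(\<Prod>i\<in>?W - A. tail_weight (p n) l j (?\<theta> i)) * l ^ a n / l ^ j
          \<le> exp ((l - 1) * (real n * (real j * p n) ^ r / fact r)) * l ^ a n / l ^ j"
        using rest l(1) by (intro divide_right_mono mult_right_mono) auto
      also have "\<dots> = l ^ a n / l ^ j * exp ((l - 1) * (real n * (real j * p n) ^ r / fact r))"
        by simp
      also have "\<dots> \<le> 1 / real n ^ 3" using elim(1) by (simp add: j_def)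
      finally show "measure_pmf.prob (random_edges (edges n) (p n))
          {f. y * q n \<le> real (card (bclose ?W ?\<theta> f))} \<le> 1 / real n ^ 3" .
    qed
  qed
qed

text \<open>The powers of \<open>l\<close> cost at most \<open>exp (\<delta> (j - a))\<close>, while
  the product gains \<open>exp (- \<delta> l X)\<close>, where \<open>X\<close> is the expected
  number of newly reached clean nodes. To first order in \<delta> the exponent is at most
  \<open>- \<delta> \<eta> q\<close>; half of it absorbs all errors.\<close>

lemma lower_exponent_pointwise:
  assumes n: "n \<ge> 1" and \<delta>: "0 < \<delta>" "\<delta> \<le> 1" and ab: "real (a + b) < real n" "r < a"
    and a: "\<bar>real a / q n - \<alpha>\<bar> \<le> \<delta>"
    and e: "p n * q n * (y + C) \<le> 1"
      "1 - \<delta> \<le> (1 - real r / real a) ^ r * (1 - p n * q n * (y + C)) * (1 - real (a + b) / real n)"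
    and y: "0 < \<eta>" "\<And>w. 0 \<le> w \<Longrightarrow> w \<le> y \<Longrightarrow> \<eta> \<le> growth_const r * w ^ r - (w - \<alpha>)"
    and \<delta>\<eta>: "\<delta> * (1 + 2 * (growth_const r * y ^ r)) \<le> \<eta> / 2"
    and jk: "a \<le> j" "real j \<le> y * q n" "real k \<le> C * q n"
  defines "l \<equiv> 1 / (1 + \<delta>)"
  shows "l ^ a / l ^ j * (1 - (1 - l) * binomial_tail (p n) j r * (1 - p n) ^ k) ^ (n - a - b)
           \<le> exp (- (\<delta> * \<eta> / 2) * q n)"
proof -
  have q: "0 < q n" and pn: "0 < p n" "p n < 1" using q_pos[OF n] p[OF n] by auto
  define w where "w = real j / q n"
  define G where "G = growth_const r * w ^ r"
  have w: "0 \<le> w" "w \<le> y" using q jk(2) by (auto simp: w_def field_simps)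
  have c: "0 \<le> growth_const r" using r by simp
  have G: "0 \<le> G" "G \<le> growth_const r * y ^ r"
    unfolding G_def using c w power_mono[OF w(2,1), of r]
    by (intro mult_nonneg_nonneg[OF c], simp, intro mult_left_mono[OF _ c])
  have l: "0 < l" "l < 1" "1 - l = \<delta> * l" using \<delta> by (auto simp: l_def field_simps)
  define \<pi> where "\<pi> = binomial_tail (p n) j r"
  define m where "m = n - a - b"
  have m: "real m = real n * (1 - real (a + b) / real n)"
    using ab(1) n by (simp add: m_def field_simps of_nat_diff)
  define X where "X = real m * (\<pi> * (1 - p n) ^ k)"
  \<comment> \<open>The three factors in the second part of \<open>e\<close> pay for replacing
    \<open>fact r * (j choose r)\<close> by \<open>j ^ r\<close>, for dropping
    \<open>(1 - p) ^ (j + k)\<close>, and for counting \<open>n\<close> instead of \<open>m\<close>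
    nodes.\<close>
  have X: "(1 - \<delta>) * (q n * G) \<le> X"
  proof -
    let ?N = "real n * (real j * p n) ^ r / fact r"
    have "q n * G = ?N" unfolding growth_eq[OF n] by (simp add: G_def w_def)
    have "0 \<le> ?N" using pn by simp
    have j: "r < j" "real a \<le> real j" using ab jk by auto
    have "real r / real j \<le> real r / real a"
      using j ab(2) by (intro divide_left_mono) auto
    then have "(1 - real r / real a) ^ r \<le> (1 - real r / real j) ^ r"
      using ab(2) by (intro power_mono) (auto simp: field_simps)
    then have "(1 - real r / real a) ^ r * real j ^ r \<le> (1 - real r / real j) ^ r * real j ^ r"
      by (rule mult_right_mono) simp
    also have "\<dots> = (real j - real r) ^ r"
      using j by (simp add: left_diff_distrib flip: power_mult_distrib)
    also have "\<dots> \<le> fact r * real (j choose r)"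
      using j by (intro falling_power_le_binomial) auto
    finally have choose: "(1 - real r / real a) ^ r * real j ^ r / fact r \<le> real (j choose r)"
      by (simp add: field_simps)
    have "1 - p n * q n * (y + C) \<le> 1 + real (j + k) * (- p n)"
    proof -
      have "p n * real (j + k) \<le> p n * (q n * (y + C))"
        using jk pn by (intro mult_left_mono) (auto simp: algebra_simps)
      then show ?thesis by (simp add: algebra_simps)
    qed
    also have "\<dots> \<le> (1 + - p n) ^ (j + k)"
      using pn by (intro Bernoulli_inequality) auto
    finally have pw: "1 - p n * q n * (y + C) \<le> (1 - p n) ^ j * (1 - p n) ^ k"
      by (simp add: power_add)
    have "(1 - \<delta>) * ?N \<le> (1 - real r / real a) ^ r * (1 - p n * q n * (y + C)) * (1 - real (a + b) / real n) * ?N"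
      using e(2) \<open>0 \<le> ?N\<close> by (rule mult_right_mono)
    also have "\<dots> = real m * (((1 - real r / real a) ^ r * real j ^ r / fact r) * p n ^ r * (1 - p n * q n * (y + C)))"
      by (simp add: m power_mult_distrib)
    also have "\<dots> \<le> real m * (real (j choose r) * p n ^ r * ((1 - p n) ^ j * (1 - p n) ^ k))"
      using choose pw pn e(1) ab(2)
      by (intro mult_left_mono mult_mono mult_right_mono) auto
    also have "\<dots> = real m * ((real (j choose r) * p n ^ r * (1 - p n) ^ j) * (1 - p n) ^ k)"
      by (simp only: mult_ac)
    also have "\<dots> \<le> X"
      unfolding X_def \<pi>_def using pn binomial_tail_ge[of "p n" j r]
      by (intro mult_left_mono mult_right_mono) auto
    finally show ?thesis by (simp only: \<open>q n * G = ?N\<close>)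
  qed
  define u where "u = (1 - l) * \<pi> * (1 - p n) ^ k"
  have "0 \<le> \<pi> \<and> \<pi> \<le> 1" unfolding \<pi>_def using pn by (intro binomial_tail_bounds) auto
  then have u: "u \<le> 1" unfolding u_def using l pn \<delta> by (auto intro!: mult_le_one power_le_one mult_nonneg_nonneg)
  have "(1 - u) ^ m \<le> exp (- u) ^ m"
    using u exp_ge_add_one_self[of "- u"] by (intro power_mono) auto
  also have "\<dots> = exp (- (\<delta> * l * X))"
    by (simp add: u_def X_def l(3) mult_ac flip: exp_of_nat_mult)
  finally have U: "(1 - u) ^ m \<le> exp (- (\<delta> * l * X))" .
  have "l ^ a / l ^ j = (1 + \<delta>) ^ (j - a)"
    using l(1) jk(1) by (simp add: l_def power_diff power_one_over field_simps)
  also have "\<dots> \<le> exp \<delta> ^ (j - a)"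
    using \<delta> exp_ge_add_one_self[of \<delta>] by (intro power_mono) auto
  also have "\<dots> = exp (\<delta> * (real j - real a))"
    using jk(1) by (simp add: of_nat_diff mult_ac flip: exp_of_nat_mult)
  finally have L: "l ^ a / l ^ j \<le> exp (\<delta> * (real j - real a))" .
  have "l ^ a / l ^ j * (1 - u) ^ m \<le> exp (\<delta> * (real j - real a)) * exp (- (\<delta> * l * X))"
    using L U u l(1) by (intro mult_mono) auto
  also have "\<dots> = exp (\<delta> * ((real j - real a) - l * X))"
    by (simp add: algebra_simps flip: exp_add)
  also have "\<dots> \<le> exp (- (\<delta> * \<eta> / 2) * q n)"
  proof -
    \<comment> \<open>One factor \<open>1 - \<delta>\<close> comes from \<open>l\<close>, the other
      from the bound on \<open>X\<close>.\<close>
    have "(1 - \<delta>) * ((1 - \<delta>) * (q n * G)) \<le> l * X"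
    proof -
      have "1 - \<delta> \<le> l" using \<delta> by (simp add: l_def field_simps)
      moreover have "0 \<le> X" unfolding X_def using \<open>0 \<le> \<pi> \<and> \<pi> \<le> 1\<close> pn by simp
      ultimately have "(1 - \<delta>) * X \<le> l * X" by (rule mult_right_mono)
      moreover have "(1 - \<delta>) * ((1 - \<delta>) * (q n * G)) \<le> (1 - \<delta>) * X"
        using X \<delta>(2) by (intro mult_left_mono) auto
      ultimately show ?thesis by linarith
    qed
    moreover have "(1 - 2 * \<delta>) * (q n * G) \<le> (1 - \<delta>) * ((1 - \<delta>) * (q n * G))"
    proof -
      have "(1 - 2 * \<delta>) \<le> (1 - \<delta>) * (1 - \<delta>)" by (simp add: algebra_simps)
      then have "(1 - 2 * \<delta>) * (q n * G) \<le> (1 - \<delta>) * (1 - \<delta>) * (q n * G)"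
        using q G by (intro mult_right_mono) auto
      then show ?thesis by (simp only: mult.assoc)
    qed
    moreover have "real j - real a \<le> (w - \<alpha> + \<delta>) * q n"
    proof -
      have "\<alpha> - \<delta> \<le> real a / q n" using a by linarith
      then have "(\<alpha> - \<delta>) * q n \<le> real a" using q by (simp add: field_simps)
      moreover have "real j = w * q n" using q by (simp add: w_def)
      ultimately show ?thesis by (simp add: algebra_simps)
    qed
    ultimately have "(real j - real a) - l * X \<le> (w - \<alpha> + \<delta>) * q n - (1 - 2 * \<delta>) * (q n * G)"
      by linarith
    also have "\<dots> = ((w - \<alpha>) - G + \<delta> * (1 + 2 * G)) * q n" by (simp add: algebra_simps)
    also have "\<dots> \<le> (- \<eta> + \<eta> / 2) * q n"
    proof (intro mult_right_mono add_mono)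
      show "(w - \<alpha>) - G \<le> - \<eta>" using y(2)[OF w] by (simp add: G_def)
      have "\<delta> * (1 + 2 * G) \<le> \<delta> * (1 + 2 * (growth_const r * y ^ r))"
        using \<delta> G(2) by (intro mult_left_mono add_left_mono) auto
      then show "\<delta> * (1 + 2 * G) \<le> \<eta> / 2" using \<delta>\<eta> by linarith
    qed (use q in simp)
    finally have "\<delta> * ((real j - real a) - l * X) \<le> \<delta> * ((- \<eta> + \<eta> / 2) * q n)"
      using \<delta> by (intro mult_left_mono) auto
    then show ?thesis by (simp only: exp_le_cancel_iff) (simp add: algebra_simps)
  qed
  finally show ?thesis by (simp only: u_def m_def \<pi>_def)
qed

lemma count_div_n_tendsto:
  assumes "(\<lambda>n. real (a n) / q n) \<longlonglongrightarrow> \<alpha>"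
  shows "(\<lambda>n. real (a n) / real n) \<longlonglongrightarrow> 0"
proof -
  have "(\<lambda>n. real (a n) / q n * (q n / real n)) \<longlonglongrightarrow> \<alpha> * 0"
    by (intro tendsto_mult assms q_div_n_tendsto)
  moreover have "eventually (\<lambda>n. real (a n) / q n * (q n / real n) = real (a n) / real n) sequentially"
    using eventually_ge_at_top[of 1]
    by eventually_elim (use q_pos in \<open>force simp: field_simps\<close>)
  ultimately have "(\<lambda>n. real (a n) / real n) \<longlonglongrightarrow> \<alpha> * 0"
    by (rule Lim_transform_eventually)
  then show ?thesis by simp
qed

lemma count_at_top:
  assumes "(\<lambda>n. real (a n) / q n) \<longlonglongrightarrow> \<alpha>" "0 < \<alpha>"
  shows "filterlim (\<lambda>n. real (a n)) at_top sequentially"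
proof -
  have "filterlim (\<lambda>n. real (a n) / q n * q n) at_top sequentially"
    by (rule filterlim_tendsto_pos_mult_at_top[OF assms q_at_top])
  moreover have "eventually (\<lambda>n. real (a n) / q n * q n = real (a n)) sequentially"
    using eventually_ge_at_top[of 1] by eventually_elim (use q_pos in force)
  ultimately show ?thesis by (simp add: filterlim_cong[OF refl refl])
qed

text \<open>One \<open>l\<close> must serve all sizes \<open>j\<close> and \<open>k\<close> at once.
  The power 5 leaves room for a union over at most \<open>4 n ^ 2\<close> pairs of sizes.\<close>

lemma lower_exponent:
  assumes a: "(\<lambda>n. real (a n) / q n) \<longlonglongrightarrow> \<alpha>" "0 < \<alpha>" and b: "(\<lambda>n. real (b n) / q n) \<longlonglongrightarrow> \<beta>"
    and y: "0 \<le> y" "0 < \<eta>" "\<And>w. 0 \<le> w \<Longrightarrow> w \<le> y \<Longrightarrow> \<eta> \<le> growth_const r * w ^ r - (w - \<alpha>)"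
  obtains l where "0 < l" "l < 1"
    "eventually (\<lambda>n. \<forall>j k. a n \<le> j \<longrightarrow> real j \<le> y * q n \<longrightarrow> real k \<le> C * q n \<longrightarrow>
       l ^ a n / l ^ j * (1 - (1 - l) * binomial_tail (p n) j r * (1 - p n) ^ k) ^ (n - a n - b n)
         \<le> 1 / real n ^ 5) sequentially"
proof -
  define g where "g = 1 + 2 * (growth_const r * y ^ r)"
  have "0 \<le> growth_const r * y ^ r" using y(1) r by simp
  then have g: "1 \<le> g" unfolding g_def by linarith
  \<comment> \<open>Chosen so that the second-order error \<open>\<delta> * g\<close> is at most
    half of \<eta>.\<close>
  define \<delta> where "\<delta> = min 1 (\<eta> / (2 * g))"
  have \<delta>: "0 < \<delta>" "\<delta> \<le> 1" using y(2) g by (auto simp: \<delta>_def)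
  have "\<delta> * g \<le> \<eta> / (2 * g) * g" using g by (intro mult_right_mono) (auto simp: \<delta>_def)
  then have \<delta>\<eta>: "\<delta> * g \<le> \<eta> / 2" using g by simp
  define l where "l = 1 / (1 + \<delta>)"
  have l: "0 < l" "l < 1" using \<delta> by (auto simp: l_def)
  have lim_ab: "(\<lambda>n. real (a n + b n) / real n) \<longlonglongrightarrow> 0"
    using tendsto_add[OF count_div_n_tendsto[OF a(1)] count_div_n_tendsto[OF b]]
    by (simp add: add_divide_distrib)
  have lim_pq: "(\<lambda>n. p n * q n * (y + C)) \<longlonglongrightarrow> 0"
    using tendsto_mult_right[OF pq_tendsto, of "y + C"] by simp
  have lim_a: "(\<lambda>n. real r / real (a n)) \<longlonglongrightarrow> 0"
    by (intro real_tendsto_divide_at_top[OF tendsto_const count_at_top[OF a]])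
  have lim_e: "(\<lambda>n. (1 - real r / real (a n)) ^ r * (1 - p n * q n * (y + C)) * (1 - real (a n + b n) / real n))
      \<longlonglongrightarrow> (1 - 0) ^ r * (1 - 0) * (1 - 0)"
    by (intro tendsto_intros lim_a lim_pq lim_ab)
  have "0 < \<delta> * \<eta> / 2" using \<delta> y(2) by simp
  note small = exp_minus_q_le[OF this, of 5]
  have ev_a: "eventually (\<lambda>n. \<bar>real (a n) / q n - \<alpha>\<bar> < \<delta>) sequentially"
    using tendstoD[OF a(1) \<delta>(1)] by (simp add: dist_real_def)
  have ev_r: "eventually (\<lambda>n. real r < real (a n)) sequentially"
    using count_at_top[OF a] unfolding filterlim_at_top_dense by blast
  have "eventually (\<lambda>n. real (a n + b n) / real n < 1) sequentially"
    using lim_ab by (rule order_tendstoD) simp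
  moreover have "eventually (\<lambda>n. p n * q n * (y + C) < 1) sequentially"
    using lim_pq by (rule order_tendstoD) simp
  moreover have "eventually (\<lambda>n. 1 - \<delta> <
      (1 - real r / real (a n)) ^ r * (1 - p n * q n * (y + C)) * (1 - real (a n + b n) / real n)) sequentially"
    using lim_e by (rule order_tendstoD) (use \<delta> in simp)
  ultimately have "eventually (\<lambda>n. \<forall>j k. a n \<le> j \<longrightarrow> real j \<le> y * q n \<longrightarrow> real k \<le> C * q n \<longrightarrow>
       l ^ a n / l ^ j * (1 - (1 - l) * binomial_tail (p n) j r * (1 - p n) ^ k) ^ (n - a n - b n)
         \<le> 1 / real n ^ 5) sequentially"
    using small ev_a ev_r eventually_ge_at_top[of 1]
  proof eventually_elim
    case (elim n)
    show ?case
    proof (intro allI impI)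
      fix j k assume jk: "a n \<le> j" "real j \<le> y * q n" "real k \<le> C * q n"
      have "l ^ a n / l ^ j * (1 - (1 - l) * binomial_tail (p n) j r * (1 - p n) ^ k) ^ (n - a n - b n)
          \<le> exp (- (\<delta> * \<eta> / 2) * q n)"
        unfolding l_def
        by (rule lower_exponent_pointwise[OF elim(7) \<delta>, where \<alpha> = \<alpha> and y = y and C = C])
          (use elim jk y \<delta>\<eta> in \<open>simp_all add: g_def field_simps\<close>)
      with elim(4) show "l ^ a n / l ^ j * (1 - (1 - l) * binomial_tail (p n) j r * (1 - p n) ^ k) ^ (n - a n - b n)
          \<le> 1 / real n ^ 5" by linarith
    qed
  qed
  with l show thesis by (rule that)
qed

lemma prob_safe_small:
  assumes a: "(\<lambda>n. real (a n) / q n) \<longlonglongrightarrow> \<alpha>" "0 < \<alpha>" and b: "(\<lambda>n. real (b n) / q n) \<longlonglongrightarrow> \<beta>"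
    and y: "0 \<le> y" "0 < \<eta>" "\<forall>w. 0 \<le> w \<longrightarrow> w \<le> y \<longrightarrow> \<eta> \<le> growth_const r * w ^ r - (w - \<alpha>)"
  shows "eventually (\<lambda>n. \<forall>A B. A \<subseteq> {1..n} \<longrightarrow> B \<subseteq> {1..n} \<longrightarrow> card A = a n \<longrightarrow> card B = b n \<longrightarrow> A \<inter> B = {} \<longrightarrow>
    measure_pmf.prob (random_edges (edges n) (p n))
      {f. real (card (bclose ({1..n} - A) (\<lambda>i. if i \<in> B then 0 else r) f)) \<le> C * q n \<and>
          real (card (bclose (clean {1..n} A r (\<lambda>i. if i \<in> B then 0 else r) f
                               (bclose ({1..n} - A) (\<lambda>i. if i \<in> B then 0 else r) f))
                         (\<lambda>i. if i \<in> A then 0 else r) f)) \<le> y * q n} \<le> 4 / real n ^ 3) sequentially"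
proof -
  obtain l where l: "0 < l" "l < 1"
    "eventually (\<lambda>n. \<forall>j k. a n \<le> j \<longrightarrow> real j \<le> y * q n \<longrightarrow> real k \<le> C * q n \<longrightarrow>
       l ^ a n / l ^ j * (1 - (1 - l) * binomial_tail (p n) j r * (1 - p n) ^ k) ^ (n - a n - b n)
         \<le> 1 / real n ^ 5) sequentially"
    by (rule lower_exponent[OF a b y(1,2) y(3)[rule_format]])
  from l(3) eventually_ge_at_top[of 1] show ?thesis
  proof eventually_elim
    case (elim n)
    have pn: "0 \<le> p n" "p n \<le> 1" using p[OF elim(2)] by auto
    show ?case
    proof (intro allI impI)
      fix A B assume A: "A \<subseteq> {1..n}" and B: "B \<subseteq> {1..n}" and card: "card A = a n" "card B = b n"
        and disj: "A \<inter> B = {}"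
      let ?P = "measure_pmf.prob (random_edges (edges n) (p n))"
      let ?\<theta> = "\<lambda>i. if i \<in> B then 0 else r"
      define K where "K f = bclose ({1..n} - A) ?\<theta> f" for f
      define S where "S f = bclose (clean {1..n} A r ?\<theta> f (K f)) (\<lambda>i. if i \<in> A then 0 else r) f" for f
      have fin: "finite A" "finite B" using A B by (auto intro: finite_subset)
      have K: "K f \<subseteq> {1..n} - A" for f unfolding K_def by (rule bclose_subset)
      have S: "S f \<subseteq> {1..n}" for f
        using bclose_subset[of "clean {1..n} A r ?\<theta> f (K f)" "\<lambda>i. if i \<in> A then 0 else r" f]
        unfolding S_def clean_def by blast
      \<comment> \<open>The seeds always belong to the safe closure, so only sizes
        \<open>j \<ge> a n\<close> occur, as the exponent bound requires.\<close>
      have AS: "A \<subseteq> S f" for f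
      proof
        fix i assume "i \<in> A"
        then have "i \<in> clean {1..n} A r ?\<theta> f (K f)" using A K[of f] by (auto simp: clean_def)
        then show "i \<in> S f" unfolding S_def using \<open>i \<in> A\<close> by (intro bclose_zero) auto
      qed
      have card_le: "card (K f) \<le> n" "card (S f) \<le> n" "a n \<le> card (S f)" for f
        using card_mono[of "{1..n}" "K f"] card_mono[of "{1..n}" "S f"] K[of f] S[of f] AS[of f]
          finite_subset[OF S[of f]] card_mono[of "S f" A] card by auto
      define I where "I = {(k, j). k \<le> n \<and> j \<le> n \<and> a n \<le> j \<and> real k \<le> C * q n \<and> real j \<le> y * q n}"
      have I: "I \<subseteq> {..n} \<times> {..n}" by (auto simp: I_def)
      then have "finite I" "card I \<le> (n + 1)\<^sup>2"
        using card_mono[OF _ I] by (auto simp: power2_eq_square intro: finite_subset)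
      let ?ev = "\<lambda>(k, j). {f. card (K f) = k \<and> card (S f) = j}"
      have "{f. real (card (K f)) \<le> C * q n \<and> real (card (S f)) \<le> y * q n} \<subseteq> (\<Union>x\<in>I. ?ev x)"
        using card_le by (auto simp: I_def)
      then have "?P {f. real (card (K f)) \<le> C * q n \<and> real (card (S f)) \<le> y * q n} \<le> ?P (\<Union>x\<in>I. ?ev x)"
        by (intro measure_pmf.finite_measure_mono) auto
      also have "\<dots> \<le> (\<Sum>x\<in>I. ?P (?ev x))"
        using \<open>finite I\<close> by (intro measure_pmf.finite_measure_subadditive_finite) auto
      also have "\<dots> \<le> (\<Sum>x\<in>I. 1 / real n ^ 5)"
      proof (intro sum_mono)
        fix x assume "x \<in> I"
        then obtain k j where x: "x = (k, j)" and kj: "a n \<le> j" "real k \<le> C * q n" "real j \<le> y * q n"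
          by (auto simp: I_def)
        let ?b = "1 - (1 - l) * binomial_tail (p n) j r * (1 - p n) ^ k"
        have "?P (?ev x) \<le> l ^ card A / l ^ j * (\<Prod>i\<in>{1..n} - A. if ?\<theta> i = r then ?b else 1)"
          unfolding x K_def S_def prod.case using A r pn l(1,2)
          by (intro prob_card_blocked_bclose_eq finite_edges pairs_subset_edges) auto
        also have "(\<Prod>i\<in>{1..n} - A. if ?\<theta> i = r then ?b else 1)
            = (\<Prod>i\<in>{i \<in> {1..n} - A. ?\<theta> i = r}. ?b)"
          by (rule prod.inter_filter[symmetric]) simp
        also have "{i \<in> {1..n} - A. ?\<theta> i = r} = {1..n} - A - B" using r by auto
        also have "(\<Prod>i\<in>{1..n} - A - B. ?b) = ?b ^ (n - a n - b n)"
        proof -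
          have "card ({1..n} - A - B) = n - a n - b n"
            using fin A B disj card by (subst card_Diff_subset; (subst card_Diff_subset)?) auto
          then show ?thesis by simp
        qed
        also have "l ^ card A / l ^ j * ?b ^ (n - a n - b n) \<le> 1 / real n ^ 5"
          using elim(1) kj card by simp
        finally show "?P (?ev x) \<le> 1 / real n ^ 5" .
      qed
      also have "\<dots> = real (card I) * (1 / real n ^ 5)" by simp
      also have "\<dots> \<le> (2 * real n)\<^sup>2 * (1 / real n ^ 5)"
      proof (rule mult_right_mono)
        have "real (card I) \<le> real ((n + 1)\<^sup>2)" using \<open>card I \<le> (n + 1)\<^sup>2\<close> by (simp only: of_nat_le_iff)
        also have "\<dots> = (real n + 1)\<^sup>2" by simp
        also have "\<dots> \<le> (2 * real n)\<^sup>2" using elim(2) by (intro power_mono) auto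
        finally show "real (card I) \<le> (2 * real n)\<^sup>2" .
      qed simp
      also have "\<dots> = 4 / real n ^ 3"
        using elim(2) by (simp add: power2_eq_square field_simps eval_nat_numeral)
      finally show "?P {f. real (card (bclose ({1..n} - A) ?\<theta> f)) \<le> C * q n \<and>
          real (card (bclose (clean {1..n} A r ?\<theta> f (bclose ({1..n} - A) ?\<theta> f))
                         (\<lambda>i. if i \<in> A then 0 else r) f)) \<le> y * q n} \<le> 4 / real n ^ 3"
        by (simp only: K_def S_def)
    qed
  qed
qed

end

section \<open>Almost sure convergence\<close>

lemma AE_pair_fst:
  assumes "sigma_finite_measure N" "AE x in M. P x"
  shows "AE x in M \<Otimes>\<^sub>M N. P (fst x)"
proof -
  interpret sigma_finite_measure N by fact
  obtain A where A: "{x \<in> space M. \<not> P x} \<subseteq> A" "emeasure M A = 0" "A \<in> sets M"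
    using assms(2) by (rule AE_E)
  show ?thesis
  proof (rule AE_I)
    show "{x \<in> space (M \<Otimes>\<^sub>M N). \<not> P (fst x)} \<subseteq> A \<times> space N"
      using A(1) by (auto simp: space_pair_measure)
    show "emeasure (M \<Otimes>\<^sub>M N) (A \<times> space N) = 0"
      using A(2,3) by (simp add: emeasure_pair_measure_Times)
  qed (use A in auto)
qed

lemma AE_pair_snd:
  assumes "sigma_finite_measure N" "AE x in N. P x"
  shows "AE x in M \<Otimes>\<^sub>M N. P (snd x)"
proof -
  interpret sigma_finite_measure N by fact
  obtain A where A: "{x \<in> space N. \<not> P x} \<subseteq> A" "emeasure N A = 0" "A \<in> sets N"
    using assms(2) by (rule AE_E)
  show ?thesis
  proof (rule AE_I)
    show "{x \<in> space (M \<Otimes>\<^sub>M N). \<not> P (snd x)} \<subseteq> space M \<times> A"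
      using A(1) by (auto simp: space_pair_measure)
    show "emeasure (M \<Otimes>\<^sub>M N) (space M \<times> A) = 0"
      using A(2,3) by (simp add: emeasure_pair_measure_Times)
  qed (use A in auto)
qed

lemma prob_space_clocks_measure: "prob_space (clocks_measure n)"
proof -
  have "prob_space (density lborel (\<lambda>x. ennreal (exponential_density 1 x)))"
    by (rule prob_space_exponential_density) simp
  then show ?thesis
    unfolding clocks_measure_def by (intro prob_space_PiM)
qed

section \<open>From fixed seeds to the law of the whole sample\<close>

lemma set_seeds_pmf:
  assumes "a + b \<le> n" "s \<in> set_pmf (seeds_pmf n a b)"
  shows "fst s \<subseteq> {1..n}" "snd s \<subseteq> {1..n}" "fst s \<inter> snd s = {}" "card (fst s) = a" "card (snd s) = b"
proof -
  have ex: "\<exists>A\<subseteq>X. card A = m" if "m \<le> card X" "finite X" for X :: "nat set" and m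
    using obtain_subset_with_card_n[OF that(1)] by metis
  have fin: "finite {A. A \<subseteq> X \<and> card A = m}" if "finite X" for X :: "nat set" and m
    by (rule finite_subset[of _ "Pow X"]) (use that in auto)
  have "{A. A \<subseteq> {1..n} \<and> card A = a} \<noteq> {}"
    using ex[of a "{1..n}"] assms(1) by auto
  then have "set_pmf (pmf_of_set {A. A \<subseteq> {1..n} \<and> card A = a}) = {A. A \<subseteq> {1..n} \<and> card A = a}"
    by (intro set_pmf_of_set fin) auto
  moreover have "set_pmf (pmf_of_set {B. B \<subseteq> {1..n} - A \<and> card B = b}) = {B. B \<subseteq> {1..n} - A \<and> card B = b}"
    if "A \<subseteq> {1..n}" "card A = a" for A
  proof -
    have "card ({1..n} - A) = n - a"
      using that finite_subset[OF that(1)] by (simp add: card_Diff_subset)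
    then have "{B. B \<subseteq> {1..n} - A \<and> card B = b} \<noteq> {}"
      using ex[of b "{1..n} - A"] assms(1) by auto
    then show ?thesis by (intro set_pmf_of_set fin) auto
  qed
  ultimately have "\<exists>A B. s = (A, B) \<and> A \<subseteq> {1..n} \<and> card A = a \<and> B \<subseteq> {1..n} - A \<and> card B = b"
    using assms(2) by (auto simp: seeds_pmf_def)
  then show "fst s \<subseteq> {1..n}" "snd s \<subseteq> {1..n}" "fst s \<inter> snd s = {}" "card (fst s) = a" "card (snd s) = b"
    by auto
qed

lemma finite_seeds_pmf:
  assumes "a + b \<le> n"
  shows "finite (set_pmf (seeds_pmf n a b))"
proof (rule finite_subset)
  show "set_pmf (seeds_pmf n a b) \<subseteq> Pow {1..n} \<times> Pow {1..n}"
    using set_seeds_pmf(1,2)[OF assms] by (force simp: mem_Times_iff)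
qed auto

lemma prob_erdos_renyi:
  "measure_pmf.prob (erdos_renyi n p) {G. P G} = measure_pmf.prob (random_edges (edges n) p) {f. P {e. f e}}"
  by (simp add: erdos_renyi_def measure_map_pmf vimage_def)

text \<open>The exceptional event is enclosed in a measurable \<open>E\<close>, so measurability of
  the process as a function of the sample is never at issue. The graph is independent of the seeds,
  so a bound uniform in the seeds survives averaging; the clocks enter only through a null
  set.\<close>

lemma sample_law_bad:
  assumes ab: "a + b \<le> n" and c: "0 \<le> c"
    and bound: "\<forall>s\<in>set_pmf (seeds_pmf n a b). measure_pmf.prob (erdos_renyi n p) {G. Bad G s} \<le> c"
  shows "\<exists>E\<in>sets (sample_law n p a b). emeasure (sample_law n p a b) E \<le> ennreal c \<and>
    (AE x in sample_law n p a b. x \<notin> E \<longrightarrow> (\<exists>G s \<xi>. x = (G, s, \<xi>) \<and>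
       s \<in> set_pmf (seeds_pmf n a b) \<and> \<not> Bad G s \<and> tame n \<xi>))"
proof -
  let ?S = "set_pmf (seeds_pmf n a b)" and ?G = "measure_pmf (erdos_renyi n p)"
  let ?s = "measure_pmf (seeds_pmf n a b)" and ?C = "clocks_measure n"
  interpret C: prob_space ?C by (rule prob_space_clocks_measure)
  interpret sC: prob_space "?s \<Otimes>\<^sub>M ?C"
    by (intro prob_space_pair measure_pmf.prob_space_axioms C.prob_space_axioms)
  define E where "E = (\<Union>s\<in>?S. {G. Bad G s} \<times> ({s} \<times> space ?C))"
  have fin: "finite ?S" by (rule finite_seeds_pmf[OF ab])
  have meas: "{G. Bad G s} \<times> ({s} \<times> space ?C) \<in> sets (sample_law n p a b)" for s
    unfolding sample_law_def by (intro pair_measureI) auto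
  show ?thesis
  proof (intro bexI[of _ E] conjI)
    show "E \<in> sets (sample_law n p a b)"
      unfolding E_def using fin meas by (intro sets.finite_UN) auto
    have "emeasure (sample_law n p a b) E
        \<le> (\<Sum>s\<in>?S. emeasure (sample_law n p a b) ({G. Bad G s} \<times> ({s} \<times> space ?C)))"
      unfolding E_def using fin meas by (intro emeasure_subadditive_finite) auto
    also have "\<dots> = (\<Sum>s\<in>?S. ennreal (measure_pmf.prob (erdos_renyi n p) {G. Bad G s} * pmf (seeds_pmf n a b) s))"
    proof (intro sum.cong refl)
      fix s
      have "emeasure (sample_law n p a b) ({G. Bad G s} \<times> ({s} \<times> space ?C))
          = emeasure ?G {G. Bad G s} * emeasure (?s \<Otimes>\<^sub>M ?C) ({s} \<times> space ?C)"
        unfolding sample_law_def by (intro sC.emeasure_pair_measure_Times pair_measureI) auto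
      also have "emeasure (?s \<Otimes>\<^sub>M ?C) ({s} \<times> space ?C) = emeasure ?s {s} * emeasure ?C (space ?C)"
        by (intro C.emeasure_pair_measure_Times) auto
      also have "\<dots> = ennreal (pmf (seeds_pmf n a b) s)"
        by (simp add: C.emeasure_space_1 emeasure_pmf_single)
      finally show "emeasure (sample_law n p a b) ({G. Bad G s} \<times> ({s} \<times> space ?C))
          = ennreal (measure_pmf.prob (erdos_renyi n p) {G. Bad G s} * pmf (seeds_pmf n a b) s)"
        by (simp add: measure_pmf.emeasure_eq_measure ennreal_mult')
    qed
    also have "\<dots> = ennreal (\<Sum>s\<in>?S. measure_pmf.prob (erdos_renyi n p) {G. Bad G s} * pmf (seeds_pmf n a b) s)"
      by (intro sum_ennreal) simp
    also have "\<dots> \<le> ennreal (\<Sum>s\<in>?S. c * pmf (seeds_pmf n a b) s)"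
      by (intro ennreal_leI sum_mono mult_right_mono bound[rule_format]) auto
    also have "(\<Sum>s\<in>?S. c * pmf (seeds_pmf n a b) s) = c"
      using sum_pmf_eq_1[OF fin order_refl] by (simp flip: sum_distrib_left)
    finally show "emeasure (sample_law n p a b) E \<le> ennreal c" .
    have "AE x in sample_law n p a b. fst (snd x) \<in> ?S"
      unfolding sample_law_def
      by (intro AE_pair_snd[OF sC.sigma_finite_measure_axioms] AE_pair_fst[OF C.sigma_finite_measure_axioms])
        (rule AE_measure_pmf)
    moreover have "AE x in sample_law n p a b. tame n (snd (snd x))"
      unfolding sample_law_def
      by (intro AE_pair_snd[OF sC.sigma_finite_measure_axioms] AE_pair_snd[OF C.sigma_finite_measure_axioms] AE_tame)
    moreover have "AE x in sample_law n p a b. x \<in> space (sample_law n p a b)" by simp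
    ultimately show "AE x in sample_law n p a b. x \<notin> E \<longrightarrow> (\<exists>G s \<xi>. x = (G, s, \<xi>) \<and> s \<in> ?S \<and>
        \<not> Bad G s \<and> tame n \<xi>)"
    proof eventually_elim
      case (elim x)
      obtain G s \<xi> where x: "x = (G, s, \<xi>)" by (cases x) auto
      then have "\<xi> \<in> space ?C" using elim(3) by (simp add: sample_law_def space_pair_measure)
      then show ?case using elim(1,2) x by (auto simp: E_def)
    qed
  qed
qed

text \<open>The lower deviation is paired with a bound on the other colour's reach because only this
  joint event is estimated. Excluding the first alternative for the opposite colour supplies that
  bound.\<close>

definition deviates :: "nat \<Rightarrow> nat \<Rightarrow> (colour \<Rightarrow> real) \<Rightarrow> (colour \<Rightarrow> real) \<Rightarrow> nat set set \<Rightarrow> nat set \<times> nat set \<Rightarrow> bool" where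
  "deviates n r lo hi G s \<longleftrightarrow> (\<exists>S\<in>{Red, Black}.
     hi S \<le> real (card (reach n r G (seeds_of s S) (seeds_of s (opposite S)))) \<or>
     (real (card (reach n r G (seeds_of s (opposite S)) (seeds_of s S))) \<le> hi (opposite S) \<and>
      real (card (safe n r G (seeds_of s S) (seeds_of s (opposite S)))) \<le> lo S))"

lemma A_star_between:
  assumes "\<not> deviates n r lo hi G s" "fst s \<inter> snd s = {}" "tame n \<xi>" "0 < r" "S \<in> {Red, Black}"
  shows "lo S < real (A_star n r (G, s, \<xi>) S)" "real (A_star n r (G, s, \<xi>) S) < hi S"
proof -
  have opp: "opposite S \<in> {Red, Black}" "opposite (opposite S) = S" using assms(5) by auto
  have small: "real (card (reach n r G (seeds_of s T) (seeds_of s (opposite T)))) < hi T"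
    if "T \<in> {Red, Black}" for T
    using assms(1) that unfolding deviates_def by (meson not_le)
  have "lo S < real (card (safe n r G (seeds_of s S) (seeds_of s (opposite S))))"
    using assms(1,5) small[OF opp(1)] opp(2) unfolding deviates_def by (metis less_imp_le not_le)
  also have "\<dots> \<le> real (A_star n r (G, s, \<xi>) S)"
    using A_star_ge[OF assms(2,5,4,3)] by simp
  finally show "lo S < real (A_star n r (G, s, \<xi>) S)" .
  show "real (A_star n r (G, s, \<xi>) S) < hi S"
    using A_star_le[OF assms(2,5), of n r G \<xi>] small[OF assms(5)] by linarith
qed

context subcritical_scaling
begin

lemma prob_deviates:
  fixes a :: "colour \<Rightarrow> nat \<Rightarrow> nat" and \<alpha> :: "colour \<Rightarrow> real"
  assumes a: "\<And>S. S \<in> {Red, Black} \<Longrightarrow> (\<lambda>n. real (a S n) / q n) \<longlonglongrightarrow> \<alpha> S"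
    and \<alpha>: "\<And>S. S \<in> {Red, Black} \<Longrightarrow> 0 < \<alpha> S \<and> \<alpha> S < 1"
    and ab: "\<And>n. n \<ge> 1 \<Longrightarrow> a Red n + a Black n \<le> n" and "0 < \<epsilon>"
  shows "\<exists>lo hi. (\<forall>S\<in>{Red, Black}. least_zero r (\<alpha> S) + \<alpha> S - \<epsilon> \<le> lo S \<and>
      hi S \<le> least_zero r (\<alpha> S) + \<alpha> S + \<epsilon>) \<and>
    eventually (\<lambda>n. \<forall>s\<in>set_pmf (seeds_pmf n (a Red n) (a Black n)).
      measure_pmf.prob (erdos_renyi n (p n)) {G. deviates n r (\<lambda>S. lo S * q n) (\<lambda>S. hi S * q n) G s}
        \<le> 10 / real n ^ 3) sequentially"
proof -
  have "\<exists>lo hi. least_zero r (\<alpha> S) + \<alpha> S - \<epsilon> \<le> lo \<and> hi \<le> least_zero r (\<alpha> S) + \<alpha> S + \<epsilon> \<and>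
      0 \<le> lo \<and> 0 < hi \<and> growth_const r * hi ^ r < hi - \<alpha> S \<and>
      (\<exists>\<eta>>0. \<forall>w. 0 \<le> w \<longrightarrow> w \<le> lo \<longrightarrow> \<eta> \<le> growth_const r * w ^ r - (w - \<alpha> S))"
    if S: "S \<in> {Red, Black}" for S
  proof -
    have S': "0 < \<alpha> S" "\<alpha> S < 1" using \<alpha>[OF S] by auto
    define z where "z = least_zero r (\<alpha> S)"
    obtain x1 where z: "0 < z" "z < x1"
      and pos: "\<And>x. - \<alpha> S \<le> x \<Longrightarrow> x < z \<Longrightarrow> 0 < beta_fun r (\<alpha> S) x"
      and neg: "\<And>x. z < x \<Longrightarrow> x \<le> x1 \<Longrightarrow> beta_fun r (\<alpha> S) x < 0"
      and dec: "\<And>x y. - \<alpha> S \<le> x \<Longrightarrow> x \<le> y \<Longrightarrow> y \<le> x1 \<Longrightarrow> beta_fun r (\<alpha> S) y \<le> beta_fun r (\<alpha> S) x"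
      using least_zero_properties[OF r S', folded z_def] by blast
    \<comment> \<open>The bounds \<open>z\<close> and \<open>x1 - z\<close> keep
      \<open>z - \<delta>\<close> nonnegative and \<open>z + \<delta>\<close> in the range where
      \<open>beta_fun\<close> is negative.\<close>
    define \<delta> where "\<delta> = min \<epsilon> (min z (x1 - z))"
    have \<delta>: "0 < \<delta>" "\<delta> \<le> \<epsilon>" "\<delta> \<le> z" "\<delta> \<le> x1 - z" using z \<open>0 < \<epsilon>\<close> by (auto simp: \<delta>_def)
    show ?thesis
    proof (rule exI[of _ "z + \<alpha> S - \<delta>"], rule exI[of _ "z + \<alpha> S + \<delta>"], intro conjI)
      show "growth_const r * (z + \<alpha> S + \<delta>) ^ r < z + \<alpha> S + \<delta> - \<alpha> S"
        using neg[of "z + \<delta>"] \<delta> by (simp add: beta_fun_def add_ac)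
      \<comment> \<open>As \<open>beta_fun\<close> decreases, its value at
        \<open>z - \<delta>\<close> serves as \<eta> for the whole range below.\<close>
      have "0 < beta_fun r (\<alpha> S) (z - \<delta>)" using \<delta> S' by (intro pos) auto
      moreover have "beta_fun r (\<alpha> S) (z - \<delta>) \<le> growth_const r * w ^ r - (w - \<alpha> S)"
        if "0 \<le> w" "w \<le> z + \<alpha> S - \<delta>" for w
        using dec[of "w - \<alpha> S" "z - \<delta>"] that \<delta> z by (simp add: beta_fun_def)
      ultimately show "\<exists>\<eta>>0. \<forall>w. 0 \<le> w \<longrightarrow> w \<le> z + \<alpha> S - \<delta> \<longrightarrow> \<eta> \<le> growth_const r * w ^ r - (w - \<alpha> S)"
        by blast
    qed (use \<delta> z S' in \<open>auto simp: z_def\<close>)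
  qed
  then obtain lo hi where lohi: "\<And>S. S \<in> {Red, Black} \<Longrightarrow>
      least_zero r (\<alpha> S) + \<alpha> S - \<epsilon> \<le> lo S \<and> hi S \<le> least_zero r (\<alpha> S) + \<alpha> S + \<epsilon> \<and>
      0 \<le> lo S \<and> 0 < hi S \<and> growth_const r * hi S ^ r < hi S - \<alpha> S \<and>
      (\<exists>\<eta>>0. \<forall>w. 0 \<le> w \<longrightarrow> w \<le> lo S \<longrightarrow> \<eta> \<le> growth_const r * w ^ r - (w - \<alpha> S))"
    by metis
  let ?large = "\<lambda>S n s f. hi S * q n \<le> real (card (reach n r {e. f e} (seeds_of s S) (seeds_of s (opposite S))))"
  let ?small = "\<lambda>S n s f. real (card (reach n r {e. f e} (seeds_of s (opposite S)) (seeds_of s S))) \<le> hi (opposite S) * q n \<and>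
      real (card (safe n r {e. f e} (seeds_of s S) (seeds_of s (opposite S)))) \<le> lo S * q n"
  let ?P = "\<lambda>n. measure_pmf.prob (random_edges (edges n) (p n))"
  have one: "eventually (\<lambda>n. \<forall>s\<in>set_pmf (seeds_pmf n (a Red n) (a Black n)).
      ?P n {f. ?large S n s f} \<le> 1 / real n ^ 3 \<and> ?P n {f. ?small S n s f} \<le> 4 / real n ^ 3) sequentially"
    if S: "S \<in> {Red, Black}" for S
  proof -
    obtain \<eta> where \<eta>: "0 < \<eta>" "\<forall>w. 0 \<le> w \<longrightarrow> w \<le> lo S \<longrightarrow> \<eta> \<le> growth_const r * w ^ r - (w - \<alpha> S)"
      using lohi[OF S] by blast
    have opp: "opposite S \<in> {Red, Black}" using S by auto
    have "0 < hi S" "growth_const r * hi S ^ r < hi S - \<alpha> S" "0 \<le> lo S" "0 < \<alpha> S"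
      using lohi[OF S] \<alpha>[OF S] by auto
    note ev = prob_reach_large[OF a[OF S] this(1,2)]
      prob_safe_small[OF a[OF S] this(4) a[OF opp] this(3) \<eta>, of "hi (opposite S)"]
    from ev eventually_ge_at_top[of 1] show ?thesis
    proof eventually_elim
      case (elim n)
      show ?case
      proof
        fix s assume s: "s \<in> set_pmf (seeds_pmf n (a Red n) (a Black n))"
        note seeds = set_seeds_pmf[OF ab[OF elim(3)] s]
        have s1: "seeds_of s S \<subseteq> {1..n}" "card (seeds_of s S) = a S n"
          "seeds_of s (opposite S) \<subseteq> {1..n}" "card (seeds_of s (opposite S)) = a (opposite S) n"
          "seeds_of s S \<inter> seeds_of s (opposite S) = {}"
          using seeds S by auto
        show "?P n {f. ?large S n s f} \<le> 1 / real n ^ 3 \<and> ?P n {f. ?small S n s f} \<le> 4 / real n ^ 3"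
          using elim(1,2) s1 unfolding reach_def safe_def by simp
      qed
    qed
  qed
  have "eventually (\<lambda>n. \<forall>s\<in>set_pmf (seeds_pmf n (a Red n) (a Black n)).
       measure_pmf.prob (erdos_renyi n (p n)) {G. deviates n r (\<lambda>S. lo S * q n) (\<lambda>S. hi S * q n) G s}
         \<le> 10 / real n ^ 3) sequentially"
    using one[of Red, OF insertI1] one[of Black, OF insertI2[OF singletonI]]
  proof eventually_elim
    case (elim n)
    show ?case
    proof
      fix s assume s: "s \<in> set_pmf (seeds_pmf n (a Red n) (a Black n))"
      have "measure_pmf.prob (erdos_renyi n (p n)) {G. deviates n r (\<lambda>S. lo S * q n) (\<lambda>S. hi S * q n) G s}
          = ?P n (({f. ?large Red n s f} \<union> {f. ?small Red n s f}) \<union> ({f. ?large Black n s f} \<union> {f. ?small Black n s f}))"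
        unfolding prob_erdos_renyi deviates_def by (intro arg_cong[of _ _ "?P n"]) auto
      also have "\<dots> \<le> ?P n {f. ?large Red n s f} + ?P n {f. ?small Red n s f}
          + (?P n {f. ?large Black n s f} + ?P n {f. ?small Black n s f})"
        by (intro order_trans[OF measure_Un_le] add_mono) auto
      also have "\<dots> \<le> 1 / real n ^ 3 + 4 / real n ^ 3 + (1 / real n ^ 3 + 4 / real n ^ 3)"
        using elim s by (intro add_mono) auto
      also have "\<dots> = 10 / real n ^ 3" by simp
      finally show "measure_pmf.prob (erdos_renyi n (p n))
          {G. deviates n r (\<lambda>S. lo S * q n) (\<lambda>S. hi S * q n) G s} \<le> 10 / real n ^ 3" .
    qed
  qed
  moreover have "\<forall>S\<in>{Red, Black}. least_zero r (\<alpha> S) + \<alpha> S - \<epsilon> \<le> lo S \<and>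
      hi S \<le> least_zero r (\<alpha> S) + \<alpha> S + \<epsilon>"
    using lohi by blast
  ultimately show ?thesis by blast
qed

end

theorem theorem2p7:
  fixes r :: nat
    and p :: "nat \<Rightarrow> real"
    and a_R a_B :: "nat \<Rightarrow> nat"
    and \<alpha>_R \<alpha>_B :: real
    and M :: "'w measure"
    and X :: "nat \<Rightarrow> 'w \<Rightarrow> sample"
  assumes "r \<ge> 2"
    and "\<And>n. n \<ge> 1 \<Longrightarrow> 0 < p n \<and> p n < 1"
    and "(\<lambda>n. 1 / real n) \<in> o(p)"
    and "p \<in> o(\<lambda>n. 1 / (real n powr (1 / real r) * ln (real n)))"
    and "\<And>n. n \<ge> 1 \<Longrightarrow> a_R n + a_B n \<le> n"
    and "(\<lambda>n. real (a_R n) / crit_size r p n) \<longlonglongrightarrow> \<alpha>_R"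
    and "(\<lambda>n. real (a_B n) / crit_size r p n) \<longlonglongrightarrow> \<alpha>_B"
    and "0 < \<alpha>_B" and "\<alpha>_B < \<alpha>_R" and "\<alpha>_R < 1"
    and "prob_space M"
    and "\<And>n. n \<ge> 1 \<Longrightarrow>
           distr M (sample_law n (p n) (a_R n) (a_B n)) (X n) = sample_law n (p n) (a_R n) (a_B n)"
    and "prob_space.indep_vars M (\<lambda>n. sample_law n (p n) (a_R n) (a_B n)) X {1..}"
  shows "AE \<omega> in M.
           (\<lambda>n. real (A_star n r (X n \<omega>) Red) / crit_size r p n) \<longlonglongrightarrow> least_zero r \<alpha>_R + \<alpha>_R \<and>
           (\<lambda>n. real (A_star n r (X n \<omega>) Black) / crit_size r p n) \<longlonglongrightarrow> least_zero r \<alpha>_B + \<alpha>_B"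
proof -
  interpret subcritical_scaling r p
    by unfold_locales (use assms(1-4) in auto)
  interpret M: prob_space M by (rule assms(11))
  have X: "X n \<in> M \<rightarrow>\<^sub>M sample_law n (p n) (a_R n) (a_B n)" if "n \<ge> 1" for n
    using assms(13) that by (auto simp: M.indep_vars_def)
  define a where "a S = (if S = Red then a_R else a_B)" for S
  define \<alpha> where "\<alpha> S = (if S = Red then \<alpha>_R else \<alpha>_B)" for S
  define z where "z S = least_zero r (\<alpha> S) + \<alpha> S" for S
  have near: "AE \<omega> in M. eventually (\<lambda>n. \<forall>S\<in>{Red, Black}.
      \<bar>real (A_star n r (X n \<omega>) S) / q n - z S\<bar> \<le> \<epsilon>) sequentially" if "0 < \<epsilon>" for \<epsilon>
  proof -
    have lims: "(\<lambda>n. real (a S n) / q n) \<longlonglongrightarrow> \<alpha> S" "0 < \<alpha> S \<and> \<alpha> S < 1" for S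
      using assms(6-10) by (auto simp: a_def \<alpha>_def)
    have ab: "a Red n + a Black n \<le> n" if "n \<ge> 1" for n
      using assms(5)[OF that] by (simp add: a_def)
    obtain lo hi where
      lohi: "\<forall>S\<in>{Red, Black}. z S - \<epsilon> \<le> lo S \<and> hi S \<le> z S + \<epsilon>" and
      ev: "eventually (\<lambda>n. \<forall>s\<in>set_pmf (seeds_pmf n (a Red n) (a Black n)).
         measure_pmf.prob (erdos_renyi n (p n)) {G. deviates n r (\<lambda>S. lo S * q n) (\<lambda>S. hi S * q n) G s}
           \<le> 10 / real n ^ 3) sequentially"
      using prob_deviates[of a \<alpha> \<epsilon>, OF lims ab \<open>0 < \<epsilon>\<close>, folded z_def] by blast
    \<comment> \<open>\<open>N \<ge> 1\<close> because the law of \<open>X n\<close> is prescribed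
      only from index 1 on.\<close>
    obtain N where N: "N \<ge> 1" "\<And>n. n \<ge> N \<Longrightarrow> \<forall>s\<in>set_pmf (seeds_pmf n (a_R n) (a_B n)).
         measure_pmf.prob (erdos_renyi n (p n)) {G. deviates n r (\<lambda>S. lo S * q n) (\<lambda>S. hi S * q n) G s}
           \<le> 10 / real n ^ 3"
      using eventually_conj[OF ev eventually_ge_at_top[of 1]]
      by (auto simp: eventually_sequentially a_def)
    define P where "P n E \<longleftrightarrow> E \<in> sets (sample_law n (p n) (a_R n) (a_B n)) \<and>
        emeasure (sample_law n (p n) (a_R n) (a_B n)) E \<le> ennreal (10 / real n ^ 3) \<and>
        (AE x in sample_law n (p n) (a_R n) (a_B n). x \<notin> E \<longrightarrow>
          (\<exists>G s \<xi>. x = (G, s, \<xi>) \<and> s \<in> set_pmf (seeds_pmf n (a_R n) (a_B n)) \<and>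
             \<not> deviates n r (\<lambda>S. lo S * q n) (\<lambda>S. hi S * q n) G s \<and> tame n \<xi>))" for n E
    have "\<exists>E. P n E" if n: "n \<ge> N" for n
    proof -
      have "a_R n + a_B n \<le> n" using assms(5) n N(1) by auto
      from sample_law_bad[OF this _ N(2)[OF n]] show ?thesis
        unfolding P_def Bex_def by simp
    qed
    then have "\<forall>n. \<exists>E. n \<ge> N \<longrightarrow> P n E" by blast
    then obtain E where "\<forall>n. n \<ge> N \<longrightarrow> P n (E n)" by (rule choice[THEN exE])
    then have
      E: "\<And>n. n \<ge> N \<Longrightarrow> E n \<in> sets (sample_law n (p n) (a_R n) (a_B n))"
        "\<And>n. n \<ge> N \<Longrightarrow> emeasure (sample_law n (p n) (a_R n) (a_B n)) (E n) \<le> ennreal (10 / real n ^ 3)"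
        "\<And>n. n \<ge> N \<Longrightarrow> AE x in sample_law n (p n) (a_R n) (a_B n). x \<notin> E n \<longrightarrow>
          (\<exists>G s \<xi>. x = (G, s, \<xi>) \<and> s \<in> set_pmf (seeds_pmf n (a_R n) (a_B n)) \<and>
             \<not> deviates n r (\<lambda>S. lo S * q n) (\<lambda>S. hi S * q n) G s \<and> tame n \<xi>)"
      unfolding P_def by blast+
    \<comment> \<open>Empty below \<open>N\<close>, where nothing is known about \<open>E n\<close>,
      so that measurability and summability can be stated for all \<open>n\<close>.\<close>
    define F where "F n = (if n \<ge> N then X n -` E n \<inter> space M else {})" for n
    have F: "F n \<in> sets M" for n
      using X[of n] E(1)[of n] N(1) by (auto simp: F_def intro: measurable_sets)
    have F_le: "measure M (F n) \<le> 10 / real n ^ 3" for n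
    proof (cases "n \<ge> N")
      case True
      then have n: "n \<ge> 1" using N(1) by simp
      have "emeasure M (F n) = emeasure (distr M (sample_law n (p n) (a_R n) (a_B n)) (X n)) (E n)"
        using True X[OF n] E(1)[OF True] by (simp add: F_def emeasure_distr)
      also have "\<dots> \<le> ennreal (10 / real n ^ 3)"
        using E(2)[OF True] by (simp only: assms(12)[OF n])
      finally show ?thesis by (simp add: M.emeasure_eq_measure)
    qed (simp add: F_def)
    have "summable (\<lambda>n. measure M (F n))"
    proof (rule summable_comparison_test')
      show "summable (\<lambda>n. 10 * inverse (real n ^ 3))"
        by (intro summable_mult inverse_power_summable) simp
      show "norm (measure M (F n)) \<le> 10 * inverse (real n ^ 3)" if "n \<ge> 0" for n
        using F_le[of n] by (simp add: inverse_eq_divide)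
    qed
    then have "AE \<omega> in M. eventually (\<lambda>n. \<omega> \<in> space M - F n) sequentially"
      by (intro borel_cantelli_AE1 F) (simp_all add: M.emeasure_eq_measure)
    moreover have "AE \<omega> in M. n \<ge> N \<longrightarrow> X n \<omega> \<notin> E n \<longrightarrow>
        (\<exists>G s \<xi>. X n \<omega> = (G, s, \<xi>) \<and> s \<in> set_pmf (seeds_pmf n (a_R n) (a_B n)) \<and>
           \<not> deviates n r (\<lambda>S. lo S * q n) (\<lambda>S. hi S * q n) G s \<and> tame n \<xi>)" for n
    proof (cases "n \<ge> N")
      case True
      then have n: "n \<ge> 1" using N(1) by simp
      show ?thesis
        using AE_distrD[OF X[OF n], unfolded assms(12)[OF n], OF E(3)[OF True]] by simp
    qed simp
    then have "AE \<omega> in M. \<forall>n. n \<ge> N \<longrightarrow> X n \<omega> \<notin> E n \<longrightarrow>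
        (\<exists>G s \<xi>. X n \<omega> = (G, s, \<xi>) \<and> s \<in> set_pmf (seeds_pmf n (a_R n) (a_B n)) \<and>
           \<not> deviates n r (\<lambda>S. lo S * q n) (\<lambda>S. hi S * q n) G s \<and> tame n \<xi>)"
      unfolding AE_all_countable by (rule allI)
    ultimately show ?thesis
    proof eventually_elim
      case (elim \<omega>)
      note typical = elim(2)
      show ?case
        using elim(1) eventually_ge_at_top[of N]
      proof eventually_elim
        case (elim n)
        then have "X n \<omega> \<notin> E n" by (auto simp: F_def)
        then obtain G s \<xi> where G: "X n \<omega> = (G, s, \<xi>)" "s \<in> set_pmf (seeds_pmf n (a_R n) (a_B n))"
          "\<not> deviates n r (\<lambda>S. lo S * q n) (\<lambda>S. hi S * q n) G s" "tame n \<xi>"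
          using typical elim(2) by blast
        have n: "n \<ge> 1" using elim(2) N(1) by simp
        have q: "0 < q n" by (rule q_pos[OF n])
        have disj: "fst s \<inter> snd s = {}" by (rule set_seeds_pmf(3)[OF assms(5)[OF n] G(2)])
        show ?case
        proof
          fix S assume S: "S \<in> {Red, Black}"
          have "0 < r" using r by simp
          note between = A_star_between[OF G(3) disj G(4) this S]
          have "lo S < real (A_star n r (X n \<omega>) S) / q n" "real (A_star n r (X n \<omega>) S) / q n < hi S"
            using between q by (simp_all add: G(1) field_simps)
          with lohi[rule_format, OF S] show "\<bar>real (A_star n r (X n \<omega>) S) / q n - z S\<bar> \<le> \<epsilon>"
            by linarith
        qed
      qed
    qed
  qed
  \<comment> \<open>Countably many tolerances suffice for convergence and keep the exceptional set
    null.\<close>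
  have "AE \<omega> in M. \<forall>m. eventually (\<lambda>n. \<forall>S\<in>{Red, Black}.
      \<bar>real (A_star n r (X n \<omega>) S) / q n - z S\<bar> \<le> 1 / real (Suc m)) sequentially"
    unfolding AE_all_countable by (intro allI near) simp
  then show ?thesis
  proof eventually_elim
    case (elim \<omega>)
    have "(\<lambda>n. real (A_star n r (X n \<omega>) S) / q n) \<longlonglongrightarrow> z S" if S: "S \<in> {Red, Black}" for S
    proof (rule tendstoI)
      fix e :: real assume "0 < e"
      then obtain m where m: "1 / real (Suc m) < e" by (rule nat_approx_posE)
      show "eventually (\<lambda>n. dist (real (A_star n r (X n \<omega>) S) / q n) (z S) < e) sequentially"
        using elim[rule_format, of m]
      proof eventually_elim
        case (elim n)
        then have "\<bar>real (A_star n r (X n \<omega>) S) / q n - z S\<bar> \<le> 1 / real (Suc m)" using S by blast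
        with m show ?case by (simp only: dist_real_def)
      qed
    qed
    from this[of Red] this[of Black] show ?case by (simp add: z_def \<alpha>_def)
  qed
qed

end
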